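(* Let $k$ be a field with $\operatorname{char} k\ne 2$, let $q\in k^\times$ be not a root of unity, let $C_0$ be in the center of $U_q(\mathfrak{sl}_2)$, and let $A$ be the associated quantized symplectic oscillator algebra of rank $1$. Let $r\in k^\times$. The simple $A$-module $V(r)$ is finite dimensional if and only if $r=\pm q^n$ (for some $n\in\mathbb{Z}_{\ge 0}$) and there is a (least) integer $m>1$ so that $\alpha_{r,n-m+2}=0$. Furthermore, in this case, $$V(r)=\bigoplus_{i=0}^{n-m}V_C(q^{-i}r).$$
   Context: $U_q(\mathfrak{sl}_2)$ is the $k$-algebra generated by $E,F,K,K^{-1}$ with $KK^{-1}=K^{-1}K=1$, $KEK^{-1}=q^2E$, $KFK^{-1}=q^{-2}F$, $EF-FE=\frac{K-K^{-1}}{q-q^{-1}}$. For $C_0$ in its center, $A$ is the $k$-algebra generated by $E,F,K,K^{-1},X,Y$ with these relations together with $EX=qXE$, $EY=X+q^{-1}YE$, $FX=YK^{-1}+XF$, $FY=YF$, $KXK^{-1}=qX$, $KYK^{-1}=q^{-1}Y$, $qYX-XY=C_0$. The subalgebra of $A$ generated by $E,F,K^{\pm1}$ is $U_q(\mathfrak{sl}_2)$. For $r\in k^\times$: $Z_C(r)$ and $V_C(r)$ denote the Verma module and the simple module of highest weight $r$ over $U_q(\mathfrak{sl}_2)$ ($K$ acts by $r$ on the highest weight vector, which is killed by $E$). The Verma module over $A$ is $Z(r)=A/(AE+AX+A(K-r))$; it has a unique simple quotient $V(r)$. The direct sum decomposition of $V(r)$ is as a $U_q(\mathfrak{sl}_2)$-module.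 The scalar $c_{0,r}\in k$ is the one by which $C_0$ acts on $Z_C(r)$. For $a\in k^\times$ put $\{a\}=\frac{a-a^{-1}}{q-q^{-1}}$. For $m\ge 2$, $$\alpha_{r,m}=\sum_{j=0}^{m-2}\{q^{1-j}r\}\,c_{0,q^{-j}r}.$$
   Formalization: The condition on m is taken as 0 ≤ m ≤ n with the index n−m+2 (not m) the least integer >1 at which α_{r,·} vanishes; as printed, with m>1 least, the claim fails, e.g. for C_0=0, r=1 and for C_0=0, r=q^3. *)

theory Defs
  imports Complex_Main "HOL-Library.Poly_Mapping" "HOL-Library.FuncSet"
    "HOL-Computational_Algebra.Computational_Algebra"
begin

section \<open>Free algebras\<close>

text \<open>The free monoid on the letters \<open>'g\<close>, written additively, so that finitely supported
  functions on it form, under the convolution product of \<open>\<Rightarrow>\<^sub>0\<close>, the free associative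
  unital algebra on \<open>'g\<close>.\<close>

datatype 'g freemon = FM "'g list"

instantiation freemon :: (type) monoid_add
begin

definition zero_freemon :: "'a freemon" where "zero_freemon = FM []"

fun plus_freemon :: "'a freemon \<Rightarrow> 'a freemon \<Rightarrow> 'a freemon" where
  "plus_freemon (FM u) (FM v) = FM (u @ v)"

instance
proof
  fix a b c :: "'a freemon"
  show "a + b + c = a + (b + c)" by (cases a; cases b; cases c) simp
  show "0 + a = a" by (cases a) (simp add: zero_freemon_def)
  show "a + 0 = a" by (cases a) (simp add: zero_freemon_def)
qed

end

type_synonym ('g, 'k) free_alg = "'g freemon \<Rightarrow>\<^sub>0 'k"

definition gen :: "'g \<Rightarrow> ('g, 'k::field) free_alg" where
  "gen g = Poly_Mapping.single (FM [g]) 1"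

definition const :: "'k \<Rightarrow> ('g, 'k::field) free_alg" where
  "const c = Poly_Mapping.single 0 c"

definition map_gens :: "('g \<Rightarrow> 'h) \<Rightarrow> ('g, 'k::field) free_alg \<Rightarrow> ('h, 'k) free_alg" where
  "map_gens f a =
     (\<Sum>w\<in>Poly_Mapping.keys a. Poly_Mapping.single (map_freemon f w) (Poly_Mapping.lookup a w))"


section \<open>Ideals and left modules over a noncommutative ring\<close>

definition left_ideal :: "'a::ring_1 set \<Rightarrow> bool" where
  "left_ideal I \<longleftrightarrow> 0 \<in> I \<and> (\<forall>x\<in>I. \<forall>y\<in>I. x + y \<in> I) \<and> (\<forall>a. \<forall>x\<in>I. a * x \<in> I)"

definition two_sided_ideal :: "'a::ring_1 set \<Rightarrow> bool" where
  "two_sided_ideal I \<longleftrightarrow> left_ideal I \<and> (\<forall>a. \<forall>x\<in>I. x * a \<in> I)"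

definition left_module :: "('a::ring_1 \<Rightarrow> 'v::ab_group_add \<Rightarrow> 'v) \<Rightarrow> bool" where
  "left_module act \<longleftrightarrow>
     (\<forall>a v w. act a (v + w) = act a v + act a w) \<and>
     (\<forall>a b v. act (a + b) v = act a v + act b v) \<and>
     (\<forall>a b v. act (a * b) v = act a (act b v)) \<and>
     (\<forall>v. act 1 v = v)"

text \<open>Left modules over the quotient of \<open>'a\<close> by the two-sided ideal \<open>J\<close>.\<close>

definition left_module_mod :: "'a::ring_1 set \<Rightarrow> ('a \<Rightarrow> 'v::ab_group_add \<Rightarrow> 'v) \<Rightarrow> bool" where
  "left_module_mod J act \<longleftrightarrow> left_module act \<and> (\<forall>a\<in>J. \<forall>v. act a v = 0)"

definition submodule :: "('a::ring_1 \<Rightarrow> 'v::ab_group_add \<Rightarrow> 'v) \<Rightarrow> 'v set \<Rightarrow> bool" where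
  "submodule act W \<longleftrightarrow>
     0 \<in> W \<and> (\<forall>v\<in>W. \<forall>w\<in>W. v + w \<in> W) \<and> (\<forall>a. \<forall>w\<in>W. act a w \<in> W)"

definition simple_submodule :: "('a::ring_1 \<Rightarrow> 'v::ab_group_add \<Rightarrow> 'v) \<Rightarrow> 'v set \<Rightarrow> bool" where
  "simple_submodule act W \<longleftrightarrow>
     submodule act W \<and> W \<noteq> {0} \<and> (\<forall>U. submodule act U \<and> U \<subseteq> W \<longrightarrow> U = {0} \<or> U = W)"

text \<open>The submodule \<open>W\<close> is a homomorphic image of the left module \<open>'a / I\<close>; a homomorphism out
  of \<open>'a / I\<close> is given by one out of \<open>'a\<close> that vanishes on \<open>I\<close>.\<close>

definition quotient_of :: "'a::ring_1 set \<Rightarrow> ('a \<Rightarrow> 'v::ab_group_add \<Rightarrow> 'v) \<Rightarrow> 'v set \<Rightarrow> bool" where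
  "quotient_of I act W \<longleftrightarrow>
     (\<exists>\<phi>. (\<forall>a b. \<phi> (a + b) = \<phi> a + \<phi> b) \<and> (\<forall>a b. \<phi> (a * b) = act a (\<phi> b)) \<and>
          (\<forall>a\<in>I. \<phi> a = 0) \<and> range \<phi> = W)"

text \<open>A module over a quotient of a free algebra is a \<open>k\<close>-vector space through the constants.\<close>

definition finite_dim :: "(('g, 'k::field) free_alg \<Rightarrow> 'v::ab_group_add \<Rightarrow> 'v) \<Rightarrow> bool" where
  "finite_dim act \<longleftrightarrow> (\<exists>B. finite_dimensional_vector_space (\<lambda>c. act (const c)) B)"

definition internal_direct_sum :: "'i set \<Rightarrow> ('i \<Rightarrow> 'v::comm_monoid_add set) \<Rightarrow> bool" where
  "internal_direct_sum I W \<longleftrightarrow> (\<forall>v. \<exists>!f. f \<in> (\<Pi>\<^sub>E i\<in>I. W i) \<and> v = (\<Sum>i\<in>I. f i))"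


section \<open>The quantum group of sl2\<close>

text \<open>\<open>UKi\<close> stands for the inverse of \<open>K\<close>.\<close>

datatype ugen = UE | UF | UK | UKi

text \<open>The algebra is the quotient of the free algebra on \<open>ugen\<close> by the two-sided ideal
  \<open>U_ideal q\<close>. Its elements are handled through representatives in the free algebra.\<close>

definition U_relators :: "'k::field \<Rightarrow> (ugen, 'k) free_alg set" where
  "U_relators q =
    (let E = gen UE; F = gen UF; K = gen UK; Ki = gen UKi in
     {K * Ki - 1, Ki * K - 1,
      K * E * Ki - const (q ^ 2) * E,
      K * F * Ki - const (q powi (-2)) * F,
      E * F - F * E - const (1 / (q - inverse q)) * (K - Ki)})"

definition U_ideal :: "'k::field \<Rightarrow> (ugen, 'k) free_alg set" where
  "U_ideal q = two_sided_ideal hull (U_relators q)"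

definition central_in_U :: "'k::field \<Rightarrow> (ugen, 'k) free_alg \<Rightarrow> bool" where
  "central_in_U q C \<longleftrightarrow> (\<forall>a. C * a - a * C \<in> U_ideal q)"

text \<open>The Verma module \<open>Z\<^sub>C(r) = U / (U E + U (K - r))\<close> is the free algebra modulo the following
  left ideal.\<close>

definition U_verma_ideal :: "'k::field \<Rightarrow> 'k \<Rightarrow> (ugen, 'k) free_alg set" where
  "U_verma_ideal q r = left_ideal hull (U_ideal q \<union> {gen UE, gen UK - const r})"

definition is_VC :: "'k::field \<Rightarrow> 'k \<Rightarrow> ((ugen, 'k) free_alg \<Rightarrow> 'v::ab_group_add \<Rightarrow> 'v) \<Rightarrow> 'v set \<Rightarrow> bool"
  where "is_VC q r act W \<longleftrightarrow> simple_submodule act W \<and> quotient_of (U_verma_ideal q r) act W"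

text \<open>The scalar by which \<open>C\<close> acts on \<open>Z\<^sub>C(r)\<close>.\<close>

definition c_scalar :: "'k::field \<Rightarrow> (ugen, 'k) free_alg \<Rightarrow> 'k \<Rightarrow> 'k" where
  "c_scalar q C r = (THE c. \<forall>a. C * a - const c * a \<in> U_verma_ideal q r)"

definition qbrace :: "'k::field \<Rightarrow> 'k \<Rightarrow> 'k" where
  "qbrace q a = (a - inverse a) / (q - inverse q)"

text \<open>Only meant for \<open>m \<ge> 2\<close>.\<close>

definition alpha :: "'k::field \<Rightarrow> (ugen, 'k) free_alg \<Rightarrow> 'k \<Rightarrow> nat \<Rightarrow> 'k" where
  "alpha q C r m =
     (\<Sum>j = 0..m - 2. qbrace q (q powi (1 - int j) * r) * c_scalar q C (q powi (- int j) * r))"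

text \<open>For \<open>r = q ^ n\<close> or \<open>r = - (q ^ n)\<close> this is used with \<open>l = n - m + 2\<close> and \<open>0 \<le> m \<le> n\<close>: "least" and
  "greater than 1" refer to the index of \<open>alpha\<close>. The bound \<open>l \<le> n + 2\<close> matters: the summands of
  \<open>alpha\<close> are antisymmetric about \<open>j = n + 1\<close>, so that \<open>alpha\<close> always vanishes at index \<open>2 * n + 4\<close>.\<close>

definition least_alpha_zero :: "'k::field \<Rightarrow> (ugen, 'k) free_alg \<Rightarrow> 'k \<Rightarrow> nat \<Rightarrow> bool" where
  "least_alpha_zero q C r l \<longleftrightarrow>
     1 < l \<and> alpha q C r l = 0 \<and> (\<forall>l'. 1 < l' \<and> alpha q C r l' = 0 \<longrightarrow> l \<le> l')"


section \<open>The quantized symplectic oscillator algebra of rank 1\<close>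

datatype agen = AU ugen | AX | AY

text \<open>The last relator depends on \<open>C\<close> only through its class in the quantum group, since the
  relators of the latter are among those of \<open>A\<close>.\<close>

definition A_relators :: "'k::field \<Rightarrow> (ugen, 'k) free_alg \<Rightarrow> (agen, 'k) free_alg set" where
  "A_relators q C =
    (let E = gen (AU UE); F = gen (AU UF); K = gen (AU UK); Ki = gen (AU UKi);
         X = gen AX; Y = gen AY in
     map_gens AU ` U_relators q \<union>
     {E * X - const q * X * E,
      E * Y - (X + const (inverse q) * Y * E),
      F * X - (Y * Ki + X * F),
      F * Y - Y * F,
      K * X * Ki - const q * X,
      K * Y * Ki - const (inverse q) * Y,
      const q * Y * X - X * Y - map_gens AU C})"

definition A_ideal :: "'k::field \<Rightarrow> (ugen, 'k) free_alg \<Rightarrow> (agen, 'k) free_alg set" where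
  "A_ideal q C = two_sided_ideal hull (A_relators q C)"

text \<open>The Verma module \<open>Z(r) = A / (A E + A X + A (K - r))\<close> is the free algebra modulo the
  following left ideal.\<close>

definition A_verma_ideal :: "'k::field \<Rightarrow> (ugen, 'k) free_alg \<Rightarrow> 'k \<Rightarrow> (agen, 'k) free_alg set" where
  "A_verma_ideal q C r =
     left_ideal hull (A_ideal q C \<union> {gen (AU UE), gen AX, gen (AU UK) - const r})"

text \<open>The \<open>A\<close>-module \<open>'v\<close> is (a copy of) \<open>V(r)\<close>, the simple quotient of \<open>Z(r)\<close>.\<close>

definition is_V :: "'k::field \<Rightarrow> (ugen, 'k) free_alg \<Rightarrow> 'k \<Rightarrow>
    ((agen, 'k) free_alg \<Rightarrow> 'v::ab_group_add \<Rightarrow> 'v) \<Rightarrow> bool" where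
  "is_V q C r act \<longleftrightarrow>
     left_module_mod (A_ideal q C) act \<and> simple_submodule act UNIV \<and>
     quotient_of (A_verma_ideal q C r) act UNIV"

definition restrict_to_U :: "((agen, 'k::field) free_alg \<Rightarrow> 'v \<Rightarrow> 'v) \<Rightarrow> (ugen, 'k) free_alg \<Rightarrow> 'v \<Rightarrow> 'v"
  where "restrict_to_U act = (\<lambda>a. act (map_gens AU a))"

end

theory Submission
  imports Defs
begin

text \<open>The module \<open>V(r)\<close> is generated by a vector \<open>v\<close> of weight \<open>r\<close> killed by \<open>E\<close> and \<open>X\<close>. The proof
  follows the vectors in \<open>V(r)\<close> that have highest weight for the quantum group. Since \<open>X\<close> and \<open>Y\<close> span
  a copy of the two-dimensional representation, a vector \<open>v\<^sub>j\<close> of weight \<open>q\<^sup>-\<^sup>j r\<close> killed by \<open>E\<close> yields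
  \<^item> \<open>X v\<^sub>j\<close>, killed by \<open>E\<close> and of weight \<open>q\<^sup>1\<^sup>-\<^sup>j r\<close>, and
  \<^item> \<open>v\<^sub>j\<^sub>+\<^sub>1 = Y v\<^sub>j - {q\<^sup>1\<^sup>-\<^sup>j r}\<^sup>-\<^sup>1 F X v\<^sub>j\<close>, killed by \<open>E\<close> and of weight \<open>q\<^sup>-\<^sup>j\<^sup>-\<^sup>1 r\<close>, if the bracket is not zero.

  Starting with \<open>v\<^sub>0 = v\<close> one gets a sequence of highest weight vectors (\<open>hv\<close>). The relation
  \<open>q Y X - X Y = C\<^sub>0\<close> turns into a recursion for the scalar by which \<open>X\<close> takes \<open>v\<^sub>j\<^sub>+\<^sub>1\<close> to \<open>v\<^sub>j\<close>. Up
  to brackets it is a telescoping sum, with solution \<open>-\<alpha>\<^sub>r\<^sub>,\<^sub>j\<^sub>+\<^sub>2 / {q\<^sup>1\<^sup>-\<^sup>j r}\<close> (\<open>X_hv_Suc\<close>).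
  So, as long as \<open>v\<^sub>j\<close> is not zero, \<open>\<alpha>\<^sub>r\<^sub>,\<^sub>j\<^sub>+\<^sub>2\<close> vanishes exactly if \<open>v\<^sub>j\<^sub>+\<^sub>1\<close> is singular, that is,
  killed by both \<open>E\<close> and \<open>X\<close>.
  A singular vector of weight below \<open>r\<close> is zero, because the submodule that it generates has no
  weight \<open>r\<close> (\<open>singular_eq_0\<close>).

  If \<open>V(r)\<close> is finite dimensional, the theory of the quantum group forces \<open>r = \<plusminus>q\<^sup>n\<close>
  (\<open>finite_dim_weight\<close>). Then \<open>v\<^sub>0, \<dots>, v\<^sub>n\<^sub>+\<^sub>1\<close> are defined, and \<open>v\<^sub>n\<^sub>+\<^sub>1 = 0\<close>, because its weight
  \<open>\<plusminus>q\<^sup>-\<^sup>1\<close> is not dominant. At the first \<open>v\<^sub>j\<^sub>+\<^sub>1\<close> that is zero, \<open>\<alpha>\<^sub>r\<^sub>,\<^sub>j\<^sub>+\<^sub>2 = 0\<close>.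

  Conversely, let \<open>r = \<plusminus>q\<^sup>n\<close> and let \<open>p + 2\<close> be the least index with \<open>\<alpha>\<^sub>r\<^sub>,\<^sub>p\<^sub>+\<^sub>2 = 0\<close>, where \<open>p \<le> n\<close>. Then
  \<open>v\<^sub>0, \<dots>, v\<^sub>p\<close> are not zero and \<open>v\<^sub>p\<^sub>+\<^sub>1 = 0\<close>. By downward induction on \<open>j\<close>, starting from
  \<open>v\<^sub>p\<^sub>+\<^sub>1 = 0\<close>, the vector \<open>F\<^sup>n\<^sup>-\<^sup>j\<^sup>+\<^sup>1 v\<^sub>j\<close> is singular and hence zero (\<open>F_top_hv\<close>), so \<open>v\<^sub>j\<close> generates the
  finite-dimensional simple module of highest weight \<open>q\<^sup>-\<^sup>j r\<close>. The sum of these modules for \<open>j \<le> p\<close> is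
  stable under \<open>X\<close> and \<open>Y\<close>, hence everything (\<open>span_F_hv\<close>), and it is direct because the \<open>v\<^sub>j\<close> have
  distinct weights (\<open>W_independent\<close>).\<close>

section \<open>Free algebras and their modules\<close>

lemma const_add: "const (a + b) = const a + const b"
  by (simp add: const_def single_add)

lemma const_mult: "const (a * b) = const a * const b"
  by (simp add: const_def mult_single)

lemma const_1 [simp]: "const 1 = 1"
  by (simp add: const_def)

lemma const_0 [simp]: "const 0 = 0"
  by (simp add: const_def)

lemma free_alg_sum_induct [case_names zero single add]:
  assumes "P 0" "\<And>w c. P (Poly_Mapping.single w c)" "\<And>a b. P a \<Longrightarrow> P b \<Longrightarrow> P (a + b)"
  shows "P (a :: ('g, 'k::field) free_alg)"
proof (induction a rule: update_induct)
  case const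
  show ?case by (rule assms(1))
next
  case (update f a b)
  have "Poly_Mapping.update a b f = f + Poly_Mapping.single a b"
    using update(1) by (intro poly_mapping_eqI)
      (auto simp: lookup_update lookup_add lookup_single in_keys_iff when_def)
  then show ?case using assms(2,3) update(3) by metis
qed

lemma const_commute: "const c * a = a * const c"
proof (induction a rule: free_alg_sum_induct)
  case (single w d)
  show ?case by (simp add: const_def mult_single mult.commute)
qed (simp_all add: algebra_simps)

lemma free_alg_induct [case_names zero one add scale gen]:
  assumes "P 0" "P 1" "\<And>a b. P a \<Longrightarrow> P b \<Longrightarrow> P (a + b)"
    "\<And>c a. P a \<Longrightarrow> P (const c * a)" "\<And>g a. P a \<Longrightarrow> P (gen g * a)"
  shows "P (a :: ('g, 'k::field) free_alg)"
proof (induction a rule: free_alg_sum_induct)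
  case (single w c)
  have words: "P (Poly_Mapping.single (FM u) 1)" for u
  proof (induction u)
    case Nil
    then show ?case using assms(2) by (simp flip: zero_freemon_def)
  next
    case (Cons g u)
    have "Poly_Mapping.single (FM (g # u)) (1::'k) = gen g * Poly_Mapping.single (FM u) 1"
      by (simp add: gen_def mult_single)
    then show ?case using assms(5) Cons by metis
  qed
  have "Poly_Mapping.single w c = const c * Poly_Mapping.single w 1"
    by (simp add: const_def mult_single)
  then show ?case using words assms(4) by (metis freemon.exhaust)
qed (use assms in auto)

lemma map_gens_0 [simp]: "map_gens f 0 = 0"
  by (simp add: map_gens_def)

lemma map_gens_single: "map_gens f (Poly_Mapping.single w c) = Poly_Mapping.single (map_freemon f w) c"
  by (simp add: map_gens_def)

lemma map_gens_add: "map_gens f (a + b) = map_gens f a + map_gens f b"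
  unfolding map_gens_def by (rule setsum_keys_plus_distrib) (simp_all add: single_add)

lemma map_gens_mult: "map_gens f (a * b) = map_gens f a * map_gens f b"
proof (induction a rule: free_alg_sum_induct)
  case (single w c)
  show ?case
  proof (induction b rule: free_alg_sum_induct)
    case (single u d)
    have "map_freemon f (w + u) = map_freemon f w + map_freemon f u"
      by (cases w; cases u) simp
    then show ?case by (simp add: mult_single map_gens_single)
  qed (simp_all add: map_gens_add algebra_simps)
qed (simp_all add: map_gens_add algebra_simps)

lemma map_gens_const [simp]: "map_gens f (const c) = const c"
  by (simp add: const_def map_gens_single zero_freemon_def)

lemma map_gens_1 [simp]: "map_gens f 1 = 1"
  using map_gens_const[of f 1] by simp

lemma map_gens_gen [simp]: "map_gens f (gen g) = gen (f g)"
  by (simp add: gen_def map_gens_single)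

lemma left_ideal_hull: "left_ideal (left_ideal hull S)"
  by (rule hull_in) (auto simp: left_ideal_def)

lemma two_sided_ideal_hull: "two_sided_ideal (two_sided_ideal hull S)"
  by (rule hull_in) (auto simp: two_sided_ideal_def left_ideal_def)

locale free_module =
  fixes act :: "('g, 'k::field) free_alg \<Rightarrow> 'v::ab_group_add \<Rightarrow> 'v"
  assumes left_module: "left_module act"
begin

abbreviation scale :: "'k \<Rightarrow> 'v \<Rightarrow> 'v" (infixr "\<star>" 75) where
  "c \<star> v \<equiv> act (const c) v"

lemma act_add_right: "act a (v + w) = act a v + act a w"
  and act_add_left: "act (a + b) v = act a v + act b v"
  and act_mult: "act (a * b) v = act a (act b v)"
  and act_1 [simp]: "act 1 v = v"
  using left_module by (auto simp: left_module_def)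

sublocale vector_space "\<lambda>c. act (const c)"
  by unfold_locales (simp_all add: act_add_right act_add_left const_add const_mult act_mult)

lemma act_scale: "act a (c \<star> v) = c \<star> act a v"
  by (metis act_mult const_commute)

lemma gen_scale: "act (gen g) (c \<star> v) = c \<star> act (gen g) v"
  by (rule act_scale)

sublocale act: module_hom "\<lambda>c. act (const c)" "\<lambda>c. act (const c)" "act a" for a
  by unfold_locales (simp_all add: act_add_right act_scale)

lemma act_diff_left: "act (a - b) v = act a v - act b v"
  using act_add_left[of "a - b" b v] by (simp add: algebra_simps)

lemma act_0_left [simp]: "act 0 v = 0"
  using act_diff_left[of 0 0 v] by simp

text \<open>Since words in the generators span the free algebra, stability needs to be checked on generators
  only.\<close>

lemma submodule_iff_subspace:
  "submodule act W \<longleftrightarrow> subspace W \<and> (\<forall>g. \<forall>w\<in>W. act (gen g) w \<in> W)"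
proof safe
  assume W: "subspace W" "\<forall>g. \<forall>w\<in>W. act (gen g) w \<in> W"
  have "act a w \<in> W" if w: "w \<in> W" for a w
    using w
    by (induction a rule: free_alg_induct)
       (auto simp: act_add_left act_mult W subspace_0[OF W(1)] subspace_add[OF W(1)]
         subspace_scale[OF W(1)])
  then show "submodule act W"
    using W by (auto simp: submodule_def subspace_def)
qed (auto simp: submodule_def subspace_def)

lemma act_span:
  assumes "\<And>x. x \<in> S \<Longrightarrow> act a x \<in> span T" "x \<in> span S"
  shows "act a x \<in> span T"
  using assms(2)
  by (induction rule: span_induct_alt)
     (auto simp: act_add_right act_scale act.zero span_zero intro!: span_add span_scale assms(1))

lemma submodule_span:
  assumes "\<And>g x. x \<in> S \<Longrightarrow> act (gen g) x \<in> span S"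
  shows "submodule act (span S)"
  unfolding submodule_iff_subspace using act_span[OF assms] by auto

lemma submodule_diff:
  assumes "submodule act W" "v \<in> W" "w \<in> W" shows "v - w \<in> W"
  using assms subspace_diff submodule_iff_subspace by blast

lemma submodule_range: "submodule act (range (\<lambda>a. act a v))"
  unfolding submodule_def
  by (auto simp flip: act_mult act_add_left) (metis act_0_left rangeI)

text \<open>Working modulo a submodule \<open>N\<close> lets the statement be used both for eigenvectors in a module
  (\<open>N = {0}\<close>) and for eigenvectors in a quotient by a left ideal.\<close>

lemma eigenvectors_in_submodule:
  assumes "submodule act N" "finite I" "inj_on \<mu> I" "\<And>i. i \<in> I \<Longrightarrow> act a (w i) - \<mu> i \<star> w i \<in> N"
    "(\<Sum>i\<in>I. w i) \<in> N" "i \<in> I"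
  shows "w i \<in> N"
  using assms(2-)
proof (induction I arbitrary: w i rule: finite_induct)
  case (insert j I)
  have sub: "subspace N" using assms(1) submodule_iff_subspace by blast
  \<comment> \<open>Applying \<open>a - \<mu> j\<close> removes the summand with index \<open>j\<close> and rescales the others.\<close>
  define w' where "w' i = (\<mu> i - \<mu> j) \<star> w i" for i
  have A: "act a (\<Sum>i\<in>insert j I. w i) - \<mu> j \<star> (\<Sum>i\<in>insert j I. w i) \<in> N"
    using insert.prems(3) assms(1) by (intro submodule_diff[OF assms(1)]) (auto simp: submodule_def)
  have B: "(\<Sum>i\<in>insert j I. act a (w i) - \<mu> i \<star> w i) \<in> N"
    using insert.prems(2) by (intro subspace_sum[OF sub])
  have C: "act a (\<Sum>i\<in>insert j I. w i) - \<mu> j \<star> (\<Sum>i\<in>insert j I. w i) -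
      (\<Sum>i\<in>insert j I. act a (w i) - \<mu> i \<star> w i) = (\<Sum>i\<in>I. w' i)"
  proof -
    have "(\<Sum>i\<in>I. w' i) = (\<Sum>i\<in>I. \<mu> i \<star> w i) - \<mu> j \<star> (\<Sum>i\<in>I. w i)"
      by (simp add: w'_def scale_left_diff_distrib sum_subtractf scale_sum_right)
    then show ?thesis using insert.hyps by (simp add: act_add_right act.sum sum_subtractf)
  qed
  have sum': "(\<Sum>i\<in>I. w' i) \<in> N"
    using submodule_diff[OF assms(1) A B] C by (simp only:)
  have "act a (w' i) - \<mu> i \<star> w' i = (\<mu> i - \<mu> j) \<star> (act a (w i) - \<mu> i \<star> w i)" for i
    by (simp only: w'_def act_scale[of a] scale_right_diff_distrib scale_scale mult.commute)
  then have eig': "act a (w' i) - \<mu> i \<star> w' i \<in> N" if "i \<in> I" for i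
    using insert.prems(2)[of i] that subspace_scale[OF sub] by simp
  have wI: "w i \<in> N" if i: "i \<in> I" for i
  proof -
    have "w' i \<in> N"
      using insert.IH[OF _ eig' sum' i] insert.prems(1) by simp
    then have "inverse (\<mu> i - \<mu> j) \<star> w' i \<in> N" by (rule subspace_scale[OF sub])
    moreover have "\<mu> i \<noteq> \<mu> j" using insert.prems(1) insert.hyps i by (auto simp: inj_on_def)
    ultimately show ?thesis by (simp add: w'_def)
  qed
  have "w j = (\<Sum>i\<in>insert j I. w i) - (\<Sum>i\<in>I. w i)" using insert.hyps by simp
  also have "\<dots> \<in> N"
    by (rule submodule_diff[OF assms(1) insert.prems(3) subspace_sum[OF sub wI]])
  finally show ?case using insert.prems(4) wI by auto
qed simp

lemma submodule_0: "submodule act {0}"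
  by (auto simp: submodule_def act.zero)

lemma eigenvectors_sum_0:
  assumes "finite I" "inj_on \<mu> I" "\<And>i. i \<in> I \<Longrightarrow> act a (w i) = \<mu> i \<star> w i"
    "(\<Sum>i\<in>I. w i) = 0" "i \<in> I"
  shows "w i = 0"
  using eigenvectors_in_submodule[OF submodule_0 assms(1,2), of a w i] assms(3-) by simp


text \<open>Used with the \<open>S n\<close> consisting of eigenvectors or of vectors in a direct summand, to pass from a
  spanning set to a decomposition of \<open>x\<close>.\<close>

lemma span_UN_sum:
  assumes "x \<in> span (\<Union>n\<in>M. S n)"
  shows "\<exists>I f. finite I \<and> I \<subseteq> M \<and> (\<forall>n\<in>I. f n \<in> span (S n)) \<and> x = (\<Sum>n\<in>I. f n)"
  using assms
proof (induction rule: span_induct_alt)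
  case base
  show ?case by (rule exI[of _ "{}"]) simp
next
  case (step c y x)
  from step(1) obtain m where m: "m \<in> M" "y \<in> S m" by auto
  from step(2) obtain I f where I: "finite I" "I \<subseteq> M" "\<forall>n\<in>I. f n \<in> span (S n)" "x = (\<Sum>n\<in>I. f n)"
    by auto
  define g where "g n = (if n = m then c \<star> y else 0) + (if n \<in> I then f n else 0)" for n
  have "(\<Sum>n\<in>insert m I. if n \<in> I then f n else 0) = (\<Sum>n\<in>I. f n)"
    using I(1) by (intro sum.mono_neutral_cong_right) auto
  then have "(\<Sum>n\<in>insert m I. g n) = c \<star> y + x"
    using I(1,4) by (simp add: g_def sum.distrib sum.delta del: sum.insert)
  moreover have "\<forall>n\<in>insert m I. g n \<in> span (S n)"
    using I(3) m by (auto simp: g_def span_base span_scale span_add span_zero)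
  ultimately show ?case using I(1,2) m(1) by (metis finite_insert insert_subset)
qed

text \<open>Eigenvectors with infinitely many different eigenvalues would be an infinite independent set.\<close>

lemma eigenvectors_infinite_dim:
  assumes "finite B" "span B = UNIV" "inj \<mu>" "\<And>i::nat. act a (f i) = \<mu> i \<star> f i"
  shows "\<exists>i. f i = 0"
proof (rule ccontr)
  assume "\<not> (\<exists>i. f i = 0)"
  then have nz: "f i \<noteq> 0" for i by auto
  have inj: "inj f"
  proof (rule injI)
    fix i j assume "f i = f j"
    then have "\<mu> i \<star> f i = \<mu> j \<star> f i" using assms(4) by metis
    then have "\<mu> i = \<mu> j" using nz scale_right_imp_eq by blast
    then show "i = j" using assms(3) by (simp add: inj_eq)
  qed
  have "independent (range f)"
  proof
    assume "dependent (range f)"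
    then obtain t u where t: "finite t" "t \<subseteq> range f" "(\<Sum>v\<in>t. u v \<star> v) = 0" "\<exists>v\<in>t. u v \<noteq> 0"
      unfolding dependent_explicit by auto
    then obtain I where I: "finite I" "t = f ` I" by (meson finite_subset_image)
    have "(\<Sum>i\<in>I. u (f i) \<star> f i) = 0"
      using t(3) unfolding I(2) by (subst (asm) sum.reindex) (auto intro: inj_on_subset[OF inj])
    then have "u (f i) \<star> f i = 0" if "i \<in> I" for i
      using eigenvectors_sum_0[OF I(1), of \<mu> a "\<lambda>i. u (f i) \<star> f i"] that assms(3,4)
      by (simp add: act_scale[of a] inj_on_subset mult.commute)
    then show False using t(4) I(2) nz by auto
  qed
  then have "finite (range f)"
    using independent_span_bound[of B "range f"] assms(1,2) by auto
  then show False using inj finite_imageD by blast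
qed

lemma finite_spanning_imp_finite_dim:
  assumes "finite S" "span S = UNIV"
  shows "\<exists>B. finite_dimensional_vector_space (\<lambda>c. act (const c)) B"
proof -
  obtain B where B: "B \<subseteq> S" "independent B" "S \<subseteq> span B"
    by (rule maximal_independent_subset)
  have "span B = UNIV"
    using B(3) assms(2) by (metis span_minimal subspace_span top.extremum_uniqueI)
  then have "finite_dimensional_vector_space (\<lambda>c. act (const c)) B"
    using B assms(1) by unfold_locales (auto intro: finite_subset)
  then show ?thesis by blast
qed

end


section \<open>Weights and quantum integers\<close>

locale q_param =
  fixes q :: "'k::field"
  assumes q_nz: "q \<noteq> 0" and not_root: "\<forall>n>0. q ^ n \<noteq> 1"
begin

lemma powi_inject: "q powi a = q powi b \<longleftrightarrow> a = b"
proof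
  have *: "a \<le> b" if "q powi a = q powi b" for a b
  proof (rule ccontr)
    assume "\<not> a \<le> b"
    then have "q ^ nat (a - b) = q powi (a - b)" by (simp add: power_int_nonneg_exp)
    also have "\<dots> = 1" using that q_nz by (simp add: power_int_diff)
    finally show False using not_root \<open>\<not> a \<le> b\<close> by auto
  qed
  then show "q powi a = q powi b \<Longrightarrow> a = b" by (metis order_antisym)
qed simp

lemma q_diff_nz: "q - inverse q \<noteq> 0"
proof
  assume "q - inverse q = 0"
  then have "q ^ 2 = 1" using q_nz by (simp add: field_simps power2_eq_square)
  then show False using not_root by auto
qed

lemma qbrace_eq_0_iff:
  assumes "a \<noteq> 0"
  shows "qbrace q a = 0 \<longleftrightarrow> a = 1 \<or> a = - 1"
proof -
  have "qbrace q a = 0 \<longleftrightarrow> a - inverse a = 0" using q_diff_nz by (simp add: qbrace_def)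
  also have "\<dots> \<longleftrightarrow> a * a = 1" using assms by (auto simp: field_simps)
  finally show ?thesis by (simp add: square_eq_1_iff)
qed

text \<open>The coefficient in \<open>E F\<^sup>i\<^sup>+\<^sup>1 w = \<dots> F\<^sup>i w\<close> for a highest weight vector \<open>w\<close> of weight \<open>s\<close>.\<close>

definition EF_coeff :: "'k \<Rightarrow> nat \<Rightarrow> 'k" where
  "EF_coeff s i = qbrace q (q ^ Suc i) * qbrace q (q powi (- int i) * s)"

lemma EF_coeff_0: "EF_coeff s 0 = qbrace q s"
  using q_diff_nz by (simp add: EF_coeff_def qbrace_def)

lemma EF_coeff_Suc:
  assumes "s \<noteq> 0"
  shows "EF_coeff s (Suc i) = EF_coeff s i + qbrace q (q powi (- 2 * int (Suc i)) * s)"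
proof -
  define Q d where "Q = q ^ i" and "d = q - inverse q"
  have Q: "Q \<noteq> 0" using q_nz by (simp add: Q_def)
  have d: "d \<noteq> 0" using q_diff_nz by (simp add: d_def)
  have 1: "q powi (- int i) = inverse Q" "q powi (- int (Suc i)) = inverse (q * Q)"
    "q ^ Suc i = q * Q" "q ^ Suc (Suc i) = q * q * Q"
    unfolding power_int_minus power_int_of_nat Q_def by simp_all
  have "- 2 * int (Suc i) = - int (Suc i + Suc i)" by simp
  then have 2: "q powi (- 2 * int (Suc i)) = inverse (q * q * Q * Q)"
    by (simp only: power_int_minus power_int_of_nat power_add power_Suc Q_def mult_ac)
  define u t p where "u = inverse Q" and "t = inverse s" and "p = inverse q"
  have inv: "u * Q = 1" "p * q = 1" using Q q_nz by (simp_all add: u_def p_def)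
  have "(q * q * Q - p * p * u) * (p * u * s - q * Q * t) =
      (q * Q - p * u) * (u * s - Q * t) + (p * p * u * u * s - q * q * Q * Q * t) * (q - p)"
    using inv by algebra
  then have "(q * q * Q - p * p * u) / d * ((p * u * s - q * Q * t) / d) =
      (q * Q - p * u) / d * ((u * s - Q * t) / d) + (p * p * u * u * s - q * q * Q * Q * t) / d"
    using d by (simp add: d_def[folded p_def, symmetric] add_divide_distrib)
  then show ?thesis
    unfolding EF_coeff_def qbrace_def 1 2 d_def[symmetric]
    by (simp add: u_def t_def p_def)
qed

lemma EF_coeff_eq_0_iff:
  assumes "s \<noteq> 0"
  shows "EF_coeff s i = 0 \<longleftrightarrow> s = q ^ i \<or> s = - (q ^ i)"
proof -
  have "q ^ Suc i \<noteq> - 1"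
  proof
    assume "q ^ Suc i = - 1"
    then have "q ^ (Suc i * 2) = 1" by (simp only: power_mult) simp
    then show False using not_root by (metis nat_0_less_mult_iff zero_less_Suc zero_less_numeral)
  qed
  then have "qbrace q (q ^ Suc i) \<noteq> 0"
    using qbrace_eq_0_iff[of "q ^ Suc i"] not_root q_nz by (metis power_not_zero zero_less_Suc)
  moreover have "qbrace q (q powi (- int i) * s) = 0 \<longleftrightarrow> s = q ^ i \<or> s = - (q ^ i)"
    using assms q_nz by (subst qbrace_eq_0_iff) (auto simp: power_int_minus field_simps)
  ultimately show ?thesis by (simp add: EF_coeff_def)
qed

text \<open>The left-hand side is the scalar that accumulates when \<open>X\<close> is moved past \<open>F\<^sup>n\<^sup>+\<^sup>1\<close>. That it is a
  bracket when \<open>s\<close> is a signed power of \<open>q\<close> causes a cancellation on which the vanishing of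
  \<open>F\<^sup>n\<^sup>-\<^sup>j\<^sup>+\<^sup>1 v\<^sub>j\<close> in \<open>F_top_hv\<close> rests.\<close>

lemma geometric_sum_dominant:
  assumes "s = q ^ n \<or> s = - (q ^ n)"
  shows "inverse s * (\<Sum>t\<le>n. (q ^ 2) ^ t) = qbrace q (q * s)"
proof -
  have s: "s \<noteq> 0" using assms q_nz by auto
  have sq: "q ^ 2 \<noteq> 1" using not_root by auto
  have "s ^ 2 = (q ^ 2) ^ n" using assms by (auto simp: power_mult[symmetric] mult.commute)
  then have "(\<Sum>t\<le>n. (q ^ 2) ^ t) = (q ^ 2 * s ^ 2 - 1) / (q ^ 2 - 1)"
    using geometric_sum[OF sq, of "Suc n"] by (simp add: lessThan_Suc_atMost)
  then have "(\<Sum>t\<le>n. (q ^ 2) ^ t) * (q ^ 2 - 1) = q ^ 2 * s ^ 2 - 1"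
    using sq by simp
  then have "inverse s * (\<Sum>t\<le>n. (q ^ 2) ^ t) * (q - inverse q) = q * s - inverse (q * s)"
    using s q_nz by (simp add: field_simps power2_eq_square)
  then show ?thesis using q_diff_nz by (simp add: qbrace_def eq_divide_eq)
qed

end


section \<open>Highest weight vectors over the quantum group\<close>

text \<open>Vectors are handled modulo a submodule \<open>N\<close> that contains the values of the elements of the ideal.
  With \<open>N = {0}\<close> this describes modules over the quantum group. With left multiplication on the free
  algebra and a left ideal \<open>N\<close> it describes the quotient by that left ideal through representatives,
  in particular the universal Verma module.\<close>

locale U_module_mod = free_module act + q_param q
  for q :: "'k::field" and act :: "(ugen, 'k) free_alg \<Rightarrow> 'v::ab_group_add \<Rightarrow> 'v" +
  fixes N :: "'v set"
  assumes submodule_N: "submodule act N" and ideal_N: "a \<in> U_ideal q \<Longrightarrow> act a v \<in> N"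
begin

abbreviation "E \<equiv> act (gen UE)"
abbreviation "F \<equiv> act (gen UF)"
abbreviation "K \<equiv> act (gen UK)"
abbreviation "Ki \<equiv> act (gen UKi)"

definition eqN :: "'v \<Rightarrow> 'v \<Rightarrow> bool" (infix "\<approx>" 50) where
  "x \<approx> y \<longleftrightarrow> x - y \<in> N"

lemma subspace_N: "subspace N"
  using submodule_N submodule_iff_subspace by blast

lemma eqN_refl [simp]: "x \<approx> x"
  by (simp add: eqN_def subspace_0[OF subspace_N])

lemma eqN_sym: "x \<approx> y \<Longrightarrow> y \<approx> x"
  using subspace_neg[OF subspace_N, of "x - y"] by (simp add: eqN_def)

lemma eqN_trans [trans]: "x \<approx> y \<Longrightarrow> y \<approx> z \<Longrightarrow> x \<approx> z"
  using subspace_add[OF subspace_N, of "x - y" "y - z"] by (simp add: eqN_def)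

lemma eqN_add: "x \<approx> y \<Longrightarrow> x' \<approx> y' \<Longrightarrow> x + x' \<approx> y + y'"
  using subspace_add[OF subspace_N, of "x - y" "x' - y'"] by (simp add: eqN_def add_diff_add)

lemma eqN_diff: "x \<approx> y \<Longrightarrow> x' \<approx> y' \<Longrightarrow> x - x' \<approx> y - y'"
  using subspace_diff[OF subspace_N, of "x - y" "x' - y'"] by (simp add: eqN_def algebra_simps)

lemma eqN_act: "x \<approx> y \<Longrightarrow> act a x \<approx> act a y"
  using submodule_N unfolding eqN_def submodule_def by (metis act.diff)

lemma eqN_sum: "(\<And>i. i \<in> I \<Longrightarrow> f i \<approx> g i) \<Longrightarrow> (\<Sum>i\<in>I. f i) \<approx> (\<Sum>i\<in>I. g i)"
  unfolding eqN_def by (simp add: subspace_sum[OF subspace_N] flip: sum_subtractf)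

lemma relatorD: "a \<in> U_relators q \<Longrightarrow> act a v \<in> N"
  by (rule ideal_N) (simp add: U_ideal_def hull_inc)

lemma K_Ki: "K (Ki v) \<approx> v" and Ki_K: "Ki (K v) \<approx> v"
  and K_E_Ki: "K (E (Ki v)) \<approx> (q ^ 2) \<star> E v"
  and K_F_Ki: "K (F (Ki v)) \<approx> (q powi (-2)) \<star> F v"
  and E_F: "E (F v) \<approx> F (E v) + (1 / (q - inverse q)) \<star> (K v - Ki v)"
  using relatorD[of "gen UK * gen UKi - 1" v] relatorD[of "gen UKi * gen UK - 1" v]
    relatorD[of "gen UK * gen UE * gen UKi - const (q ^ 2) * gen UE" v]
    relatorD[of "gen UK * gen UF * gen UKi - const (q powi (-2)) * gen UF" v]
    relatorD[of "gen UE * gen UF - gen UF * gen UE - const (1 / (q - inverse q)) * (gen UK - gen UKi)" v]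
  by (simp_all add: U_relators_def Let_def eqN_def act_diff_left act_add_left act_mult diff_diff_eq)

lemma K_E: "K (E v) \<approx> (q ^ 2) \<star> E (K v)"
  by (rule eqN_trans[OF _ K_E_Ki]) (intro eqN_act eqN_sym[OF Ki_K])

lemma K_F: "K (F v) \<approx> (q powi (-2)) \<star> F (K v)"
  by (rule eqN_trans[OF _ K_F_Ki]) (intro eqN_act eqN_sym[OF Ki_K])

lemma Ki_weight:
  assumes "K x \<approx> s \<star> x" "s \<noteq> 0"
  shows "Ki x \<approx> inverse s \<star> x"
proof -
  have "Ki x \<approx> inverse s \<star> Ki (s \<star> x)" using assms(2) by (simp add: act_scale[of "gen UKi"])
  also have "\<dots> \<approx> inverse s \<star> Ki (K x)" by (intro eqN_act eqN_sym[OF assms(1)])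
  also have "\<dots> \<approx> inverse s \<star> x" by (intro eqN_act Ki_K)
  finally show ?thesis .
qed

end

locale highest_weight_mod = U_module_mod q act N
  for q :: "'k::field" and act :: "(ugen, 'k) free_alg \<Rightarrow> 'v::ab_group_add \<Rightarrow> 'v" and N +
  fixes w :: 'v and s :: 'k
  assumes E_w: "E w \<in> N" and K_w: "K w \<approx> s \<star> w" and s_nz: "s \<noteq> 0"
begin

lemma K_F_pow: "K ((F ^^ i) w) \<approx> (q powi (- 2 * int i) * s) \<star> (F ^^ i) w"
proof (induction i)
  case 0
  show ?case using K_w by simp
next
  case (Suc i)
  have "K ((F ^^ Suc i) w) \<approx> (q powi (-2)) \<star> F (K ((F ^^ i) w))" using K_F by simp
  also have "\<dots> \<approx> (q powi (-2)) \<star> F ((q powi (- 2 * int i) * s) \<star> (F ^^ i) w)"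
    by (intro eqN_act Suc)
  also have "\<dots> = (q powi (-2) * q powi (- 2 * int i) * s) \<star> (F ^^ Suc i) w"
    by (simp add: gen_scale mult.assoc)
  also have "q powi (-2) * q powi (- 2 * int i) = q powi (- 2 * int (Suc i))"
    using q_nz by (simp flip: power_int_add)
  finally show ?case .
qed

lemma Ki_F_pow: "Ki ((F ^^ i) w) \<approx> inverse (q powi (- 2 * int i) * s) \<star> (F ^^ i) w"
  by (rule Ki_weight[OF K_F_pow]) (simp add: q_nz s_nz)

lemma K_Ki_F_pow:
  "(1 / (q - inverse q)) \<star> (K ((F ^^ i) w) - Ki ((F ^^ i) w)) \<approx>
    qbrace q (q powi (- 2 * int i) * s) \<star> (F ^^ i) w"
proof -
  have "(1 / (q - inverse q)) \<star> (K ((F ^^ i) w) - Ki ((F ^^ i) w)) \<approx>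
    (1 / (q - inverse q)) \<star> ((q powi (- 2 * int i) * s) \<star> (F ^^ i) w -
      inverse (q powi (- 2 * int i) * s) \<star> (F ^^ i) w)"
    by (intro eqN_act eqN_diff K_F_pow Ki_F_pow)
  then show ?thesis by (simp add: qbrace_def scale_left_diff_distrib[symmetric])
qed

lemma E_F_pow_Suc: "E ((F ^^ Suc i) w) \<approx> EF_coeff s i \<star> (F ^^ i) w"
proof (induction i)
  case 0
  have "E (F w) \<approx> F (E w) + (1 / (q - inverse q)) \<star> (K w - Ki w)" by (rule E_F)
  also have "\<dots> \<approx> F 0 + qbrace q s \<star> w"
    using K_Ki_F_pow[of 0] E_w by (intro eqN_add eqN_act) (simp_all add: eqN_def)
  finally show ?case by (simp add: EF_coeff_0 act.zero)
next
  case (Suc i)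
  let ?y = "(F ^^ Suc i) w"
  have "E (F ?y) \<approx> F (E ?y) + (1 / (q - inverse q)) \<star> (K ?y - Ki ?y)" by (rule E_F)
  also have "\<dots> \<approx> F (EF_coeff s i \<star> (F ^^ i) w) + qbrace q (q powi (- 2 * int (Suc i)) * s) \<star> ?y"
    by (intro eqN_add eqN_act Suc K_Ki_F_pow)
  also have "\<dots> = EF_coeff s (Suc i) \<star> ?y"
    by (simp add: EF_coeff_Suc[OF s_nz] gen_scale scale_left_distrib)
  finally show ?case by simp
qed

text \<open>The triangular decomposition in a weak form: \<open>K\<close> and \<open>E\<close> map each \<open>F\<^sup>i w\<close> to a multiple of some
  \<open>F\<^sup>j w\<close>, so the span of these vectors is a submodule.\<close>

lemma act_in_span: "act a w \<in> span (range (\<lambda>i. (F ^^ i) w) \<union> N)"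
proof -
  let ?T = "span (range (\<lambda>i. (F ^^ i) w) \<union> N)"
  have *: "y \<in> ?T" if "y \<approx> c \<star> (F ^^ i) w" for y c i
  proof -
    have "(y - c \<star> (F ^^ i) w) + c \<star> (F ^^ i) w \<in> ?T"
      using that unfolding eqN_def by (intro span_add span_scale span_base) auto
    then show ?thesis by simp
  qed
  have "submodule act ?T"
  proof (rule submodule_span, elim UnE rangeE)
    fix g x assume "x \<in> N"
    then have "act (gen g) x \<in> N" using submodule_N by (auto simp: submodule_def)
    then show "act (gen g) x \<in> ?T" by (simp add: span_base)
  next
    fix g x i assume x: "x = (F ^^ i) w"
    show "act (gen g) x \<in> ?T"
    proof (cases g)
      case UE
      show ?thesis
      proof (cases i)
        case 0
        then show ?thesis using UE x E_w by (simp add: span_base)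
      next
        case (Suc j)
        then show ?thesis using UE x * [OF E_F_pow_Suc] by simp
      qed
    next
      case UF
      then have "act (gen g) x = (F ^^ Suc i) w" using x by simp
      moreover have "(F ^^ Suc i) w \<in> range (\<lambda>i. (F ^^ i) w)" by (rule rangeI)
      ultimately show ?thesis by (simp only: span_base UnI1)
    qed (simp_all only: x *[OF K_F_pow] *[OF Ki_F_pow])
  qed
  moreover have "w \<in> ?T" using rangeI[of "\<lambda>i. (F ^^ i) w" 0] by (simp add: span_base)
  ultimately show ?thesis by (auto simp: submodule_def)
qed

lemma act_expansion:
  obtains I c where "finite I" "act a w \<approx> (\<Sum>i\<in>I. c i \<star> (F ^^ i) w)"
proof -
  have "act a w \<in> {x + y |x y. x \<in> span (range (\<lambda>i. (F ^^ i) w)) \<and> y \<in> N}"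
    using act_in_span[of a] span_eq_iff[THEN iffD2, OF subspace_N] by (simp add: span_Un)
  moreover have "range (\<lambda>i. (F ^^ i) w) = (\<Union>i\<in>UNIV. {(F ^^ i) w})" by auto
  ultimately obtain x y where xy: "act a w = x + y" "x \<in> span (\<Union>i\<in>UNIV. {(F ^^ i) w})" "y \<in> N"
    by auto
  from span_UN_sum[OF xy(2)] obtain I f where I: "finite I"
    "\<forall>i\<in>I. f i \<in> span {(F ^^ i) w}" "x = (\<Sum>i\<in>I. f i)" by auto
  from I(2) have "\<forall>i\<in>I. \<exists>c. f i = c \<star> (F ^^ i) w" by (auto simp: span_singleton)
  then obtain c where c: "\<forall>i\<in>I. f i = c i \<star> (F ^^ i) w" by metis
  have "act a w \<approx> (\<Sum>i\<in>I. c i \<star> (F ^^ i) w)" using xy I(3) c by (simp add: eqN_def)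
  with I(1) show ?thesis by (rule that)
qed

lemma inj_F_weights: "inj (\<lambda>i. q powi (- 2 * int i) * s)"
  by (rule injI) (simp add: s_nz powi_inject)

text \<open>Only \<open>F\<^sup>0 w\<close> among the vectors \<open>F\<^sup>i w\<close> has weight \<open>s\<close>, since \<open>q\<close> is not a root of unity. As the
  \<open>F\<^sup>i w\<close> may be dependent or vanish modulo \<open>N\<close>, the proof separates eigenvectors instead of comparing
  coefficients.\<close>

lemma weight_space:
  assumes "K (act a w) \<approx> s \<star> act a w"
  shows "\<exists>c. act a w \<approx> c \<star> w"
proof -
  obtain I c where I: "finite I" "act a w \<approx> (\<Sum>i\<in>I. c i \<star> (F ^^ i) w)" by (rule act_expansion)
  let ?\<mu> = "\<lambda>i. q powi (- 2 * int i) * s"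
  let ?y = "\<lambda>i. (c i * (?\<mu> i - s)) \<star> (F ^^ i) w"
  have "(\<Sum>i\<in>I. ?y i) = (\<Sum>i\<in>I. c i \<star> ?\<mu> i \<star> (F ^^ i) w) - s \<star> (\<Sum>i\<in>I. c i \<star> (F ^^ i) w)"
    by (simp add: right_diff_distrib scale_left_diff_distrib sum_subtractf scale_sum_right mult.commute)
  also have "\<dots> \<approx> (\<Sum>i\<in>I. c i \<star> K ((F ^^ i) w)) - s \<star> (\<Sum>i\<in>I. c i \<star> (F ^^ i) w)"
    by (intro eqN_diff eqN_sum eqN_act eqN_sym[OF K_F_pow]) simp
  also have "\<dots> = K (\<Sum>i\<in>I. c i \<star> (F ^^ i) w) - s \<star> (\<Sum>i\<in>I. c i \<star> (F ^^ i) w)"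
    by (simp add: act.sum gen_scale)
  also have "\<dots> \<approx> K (act a w) - s \<star> act a w"
    by (intro eqN_diff eqN_act eqN_sym[OF I(2)])
  also have "\<dots> \<approx> 0" using assms by (simp add: eqN_def)
  finally have "(\<Sum>i\<in>I. ?y i) \<in> N" by (simp add: eqN_def)
  moreover have "K (?y i) - ?\<mu> i \<star> ?y i \<in> N" for i
  proof -
    have "K (?y i) \<approx> (c i * (?\<mu> i - s)) \<star> ?\<mu> i \<star> (F ^^ i) w"
      unfolding gen_scale by (intro eqN_act K_F_pow)
    then show ?thesis by (simp add: eqN_def mult.commute)
  qed
  ultimately have y: "?y i \<in> N" if "i \<in> I" for i
    using eigenvectors_in_submodule[OF submodule_N I(1), of ?\<mu> "gen UK" ?y i] that
      inj_on_subset[OF inj_F_weights] by auto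
  have "c i \<star> (F ^^ i) w \<approx> (if i = 0 then c 0 \<star> w else 0)" if "i \<in> I" for i
  proof (cases "i = 0")
    case False
    then have "?\<mu> i - s \<noteq> 0" using inj_eq[OF inj_F_weights, of i 0] by simp
    moreover have "inverse d * (c i * d) = c i" if "d \<noteq> 0" for d using that by simp
    ultimately have "inverse (?\<mu> i - s) * (c i * (?\<mu> i - s)) = c i" by blast
    then have "c i \<star> (F ^^ i) w = inverse (?\<mu> i - s) \<star> ?y i" by (simp only: scale_scale)
    then have "c i \<star> (F ^^ i) w \<in> N" using subspace_scale[OF subspace_N y[OF that]] by (simp only:)
    then show ?thesis using False by (simp add: eqN_def)
  qed simp
  then have "(\<Sum>i\<in>I. c i \<star> (F ^^ i) w) \<approx> (\<Sum>i\<in>I. if i = 0 then c 0 \<star> w else 0)"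
    by (rule eqN_sum)
  with I(2) have "act a w \<approx> (\<Sum>i\<in>I. if i = 0 then c 0 \<star> w else 0)" by (rule eqN_trans)
  also have "\<dots> = (if 0 \<in> I then c 0 else 0) \<star> w" using I(1) by (simp add: sum.delta)
  finally show ?thesis by blast
qed

end


lemma left_module_times: "left_module ((*) :: 'a::ring_1 \<Rightarrow> 'a \<Rightarrow> 'a)"
  by (simp add: left_module_def algebra_simps)

locale highest_weight = highest_weight_mod q act "{0}" w s
  for q :: "'k::field" and act :: "(ugen, 'k) free_alg \<Rightarrow> 'v::ab_group_add \<Rightarrow> 'v" and w s
begin

lemma eqN_iff_eq [simp]: "eqN x y \<longleftrightarrow> x = y"
  by (simp add: eqN_def)

lemma E_w_0 [simp]: "E w = 0"
  using E_w by simp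

lemma verma_ideal_act: "a \<in> U_verma_ideal q s \<Longrightarrow> act a w = 0"
proof -
  have "U_verma_ideal q s \<subseteq> {a. act a w = 0}"
    unfolding U_verma_ideal_def
    using ideal_N K_w
    by (intro hull_minimal) (auto simp: left_ideal_def act_add_left act_mult act_diff_left act.zero)
  then show "a \<in> U_verma_ideal q s \<Longrightarrow> act a w = 0" by auto
qed

text \<open>A central element preserves the weight space of weight \<open>s\<close> in the Verma module, and that space is
  spanned by the generator; so it acts on the Verma module by a scalar. If \<open>w \<noteq> 0\<close>, the Verma module
  has a nonzero image, hence is not zero, and the scalar is unique.\<close>

lemma central_act:
  assumes "central_in_U q C"
  shows "act C w = c_scalar q C s \<star> w"
proof (cases "w = 0")
  case False
  let ?I = "U_verma_ideal q s"
  have I: "left_ideal ?I" unfolding U_verma_ideal_def by (rule left_ideal_hull)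
  have sub: "U_ideal q \<subseteq> ?I" "gen UE \<in> ?I" "gen UK - const s \<in> ?I"
    unfolding U_verma_ideal_def by (auto intro: hull_inc)
  interpret V: free_module "(*) :: (ugen, 'k) free_alg \<Rightarrow> _"
    by unfold_locales (rule left_module_times)
  have subI: "submodule (*) ?I" using I by (auto simp: left_ideal_def submodule_def)
  interpret V: U_module_mod q "(*)" ?I
    using subI sub(1) two_sided_ideal_hull[of "U_relators q"]
    by unfold_locales (auto simp: U_ideal_def two_sided_ideal_def)
  interpret V: highest_weight_mod q "(*)" ?I 1 s
    using sub s_nz by unfold_locales (auto simp: V.eqN_def)
  have "C * gen UK - gen UK * C \<in> ?I"
    using assms sub(1) by (auto simp: central_in_U_def)
  moreover have "C * (gen UK - const s) \<in> ?I"
    using I sub(3) by (auto simp: left_ideal_def)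
  ultimately have "C * (gen UK - const s) - (C * gen UK - gen UK * C) \<in> ?I"
    by (rule V.submodule_diff[OF subI, rotated])
  then have "V.K (C * 1) - const s * (C * 1) \<in> ?I"
    by (simp add: right_diff_distrib const_commute)
  then obtain c where c: "C - const c \<in> ?I"
    using V.weight_space[of C] by (auto simp: V.eqN_def)
  have all: "C * a - const c * a \<in> ?I" for a
  proof -
    have "C * a - a * C \<in> ?I" using assms sub(1) by (auto simp: central_in_U_def)
    moreover have "a * (C - const c) \<in> ?I" using I c by (auto simp: left_ideal_def)
    ultimately have "(C * a - a * C) + a * (C - const c) \<in> ?I" using I by (auto simp: left_ideal_def)
    then show ?thesis by (simp add: right_diff_distrib const_commute)
  qed
  have act_C: "act C w = d \<star> w" if "C - const d \<in> ?I" for d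
    using verma_ideal_act[OF that] by (simp add: act_diff_left)
  have "d = c" if "\<forall>a. C * a - const d * a \<in> ?I" for d
  proof -
    have "C - const d \<in> ?I" using that[rule_format, of 1] by simp
    then have "d \<star> w = c \<star> w" using act_C c by metis
    then show ?thesis using False scale_right_imp_eq by blast
  qed
  then have "c_scalar q C s = c"
    unfolding c_scalar_def using all by (intro the_equality) auto
  then show ?thesis using act_C[OF c] by simp
qed (simp add: act.zero)

lemma act_power: "act (a ^ k) x = (act a ^^ k) x"
  by (induction k) (simp_all add: act_mult)

lemma E_pow_F_pow: "i < k \<Longrightarrow> (E ^^ k) ((F ^^ i) w) = 0"
proof (induction i arbitrary: k)
  case 0
  then obtain l where k: "k = Suc l" by (cases k) auto
  have "(E ^^ k) w = act (gen UE ^ l) (E w)" by (simp only: k act_power funpow_Suc_right o_apply)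
  then show ?case by (simp only: E_w_0 act.zero funpow_0)
next
  case (Suc i)
  then obtain l where k: "k = Suc l" "i < l" by (cases k) auto
  have "(E ^^ k) ((F ^^ Suc i) w) = act (gen UE ^ l) (E ((F ^^ Suc i) w))"
    by (simp only: k act_power funpow_Suc_right o_apply)
  also have "\<dots> = EF_coeff s i \<star> (E ^^ l) ((F ^^ i) w)"
    using E_F_pow_Suc[of i] by (simp add: act_scale[of "gen UE ^ l"] flip: act_power)
  finally show ?case using Suc.IH[OF k(2)] by simp
qed

text \<open>Each \<open>E\<close> lowers the power of \<open>F\<close> by one, and only finitely many powers occur in a given vector.\<close>

lemma E_nilpotent: "\<exists>k. (E ^^ k) (act a w) = 0"
proof -
  obtain I c where I: "finite I" "act a w = (\<Sum>i\<in>I. c i \<star> (F ^^ i) w)"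
    using act_expansion[of a] by auto
  define k where "k = Suc (Max (insert 0 I))"
  have "act (gen UE ^ k) ((F ^^ i) w) = 0" if "i \<in> I" for i
  proof -
    have "i < k" using that I(1) by (simp add: k_def less_Suc_eq_le)
    then show ?thesis by (simp add: act_power E_pow_F_pow)
  qed
  then have "act (gen UE ^ k) (act a w) = 0"
    using I(2) by (simp add: act.sum act_scale[of "gen UE ^ k"])
  then show ?thesis by (auto simp: act_power)
qed

text \<open>The vectors \<open>F\<^sup>i w\<close> have distinct weights, so some of them vanish. If \<open>F\<^sup>n\<^sup>+\<^sup>1 w\<close> is the first one, then
  \<open>E F\<^sup>n\<^sup>+\<^sup>1 w = 0\<close> forces the coefficient of \<open>F\<^sup>n w\<close> to be zero, which happens only for
  signed powers of \<open>q\<close>.\<close>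

lemma finite_dim_weight:
  assumes "finite B" "span B = UNIV" "w \<noteq> 0"
  shows "\<exists>n. s = q ^ n \<or> s = - (q ^ n)"
proof -
  have ex: "\<exists>i. (F ^^ i) w = 0"
    by (rule eigenvectors_infinite_dim[OF assms(1,2) inj_F_weights, of "gen UK"]) (use K_F_pow in simp)
  define i where "i = (LEAST i. (F ^^ i) w = 0)"
  have i: "(F ^^ i) w = 0" unfolding i_def by (rule LeastI_ex[OF ex])
  then obtain n where n: "i = Suc n" using assms(3) by (cases i) auto
  then have "(F ^^ n) w \<noteq> 0" using not_less_Least[of n "\<lambda>i. (F ^^ i) w = 0"] by (simp add: i_def)
  moreover have "EF_coeff s n \<star> (F ^^ n) w = 0"
    using E_F_pow_Suc[of n] i unfolding n eqN_iff_eq by (simp only: act.zero)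
  ultimately show ?thesis using EF_coeff_eq_0_iff[OF s_nz] by auto
qed

end

locale finite_highest_weight = highest_weight q act w s
  for q :: "'k::field" and act :: "(ugen, 'k) free_alg \<Rightarrow> 'v::ab_group_add \<Rightarrow> 'v" and w s +
  fixes n :: nat
  assumes dominant: "s = q ^ n \<or> s = - (q ^ n)" and F_top: "(F ^^ Suc n) w = 0"
begin

lemma EF_coeff_nz: "i \<noteq> n \<Longrightarrow> EF_coeff s i \<noteq> 0"
proof
  assume "i \<noteq> n" "EF_coeff s i = 0"
  then have "(q ^ n) ^ 2 = (q ^ i) ^ 2"
    using dominant EF_coeff_eq_0_iff[OF s_nz, of i]
    by (elim disjE; simp del: power_mult; metis power2_minus)
  then have "q powi int (n * 2) = q powi int (i * 2)" by (simp only: power_int_of_nat power_mult)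
  then show False using \<open>i \<noteq> n\<close> unfolding powi_inject by simp
qed

lemma F_pow_eq_0: "n < i \<Longrightarrow> (F ^^ i) w = 0"
proof (induction i)
  case (Suc i)
  then show ?case using F_top by (cases "i = n") (auto simp: act.zero)
qed simp

text \<open>The images under \<open>E\<close> of the components along the \<open>F\<^sup>i w\<close> have distinct weights, so each of them is
  zero; and for \<open>i > 0\<close> the coefficient in \<open>E F\<^sup>i w\<close> vanishes only where \<open>F\<^sup>i w\<close> itself does.\<close>

lemma E_kernel:
  assumes "E (act a w) = 0"
  shows "\<exists>c. act a w = c \<star> w"
proof -
  obtain I c where I: "finite I" "act a w = (\<Sum>i\<in>I. c i \<star> (F ^^ i) w)"
    using act_expansion[of a] by auto
  let ?\<mu> = "\<lambda>i. q ^ 2 * (q powi (- 2 * int i) * s)"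
  have "K (c i \<star> E ((F ^^ i) w)) = ?\<mu> i \<star> c i \<star> E ((F ^^ i) w)" for i
    using K_E[of "(F ^^ i) w"] K_F_pow[of i] by (simp add: gen_scale mult.commute)
  moreover have "(\<Sum>i\<in>I. c i \<star> E ((F ^^ i) w)) = 0"
    using assms I(2) by (simp add: act.sum gen_scale)
  moreover have "inj_on ?\<mu> I"
    using inj_F_weights q_nz by (auto simp: inj_on_def)
  ultimately have 0: "c i \<star> E ((F ^^ i) w) = 0" if "i \<in> I" for i
    using eigenvectors_sum_0[OF I(1), of ?\<mu> "gen UK" "\<lambda>i. c i \<star> E ((F ^^ i) w)"] that by blast
  have "c i \<star> (F ^^ i) w = (if i = 0 then c 0 \<star> w else 0)" if i: "i \<in> I" for i
  proof (cases i)
    case (Suc j)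
    have "j = n \<or> c i = 0 \<or> (F ^^ j) w = 0"
      using 0[OF i] E_F_pow_Suc[of j] EF_coeff_nz[of j] Suc by auto
    then show ?thesis using Suc F_top by (auto simp: act.zero)
  qed simp
  then have "act a w = (\<Sum>i\<in>I. if i = 0 then c 0 \<star> w else 0)"
    using I(2) by (simp cong: sum.cong)
  also have "\<dots> = (if 0 \<in> I then c 0 else 0) \<star> w" using I(1) by (simp add: sum.delta)
  finally show ?thesis by blast
qed

text \<open>A nonzero submodule contains a nonzero vector killed by \<open>E\<close>, because \<open>E\<close> is nilpotent on each
  vector; and such vectors are multiples of the generator.\<close>

lemma simple_submodule_range:
  assumes "w \<noteq> 0"
  shows "simple_submodule act (range (\<lambda>a. act a w))"
  unfolding simple_submodule_def
proof (intro conjI allI impI)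
  show "submodule act (range (\<lambda>a. act a w))" by (rule submodule_range)
  show "range (\<lambda>a. act a w) \<noteq> {0}" using assms by (metis act_1 rangeI singletonD)
next
  fix U assume U: "submodule act U \<and> U \<subseteq> range (\<lambda>a. act a w)"
  show "U = {0} \<or> U = range (\<lambda>a. act a w)"
  proof (rule disjCI)
    assume "U \<noteq> range (\<lambda>a. act a w)"
    have stable: "act a x \<in> U" if "x \<in> U" for a x using U that by (auto simp: submodule_def)
    have w: "w \<notin> U"
    proof
      assume "w \<in> U"
      then have "range (\<lambda>a. act a w) \<subseteq> U" using stable by auto
      with U \<open>U \<noteq> _\<close> show False by auto
    qed
    have "x = 0" if x: "x \<in> U" for x
    proof (rule ccontr)
      assume "x \<noteq> 0"
      have ex: "\<exists>k. (E ^^ k) x = 0" using x U E_nilpotent by blast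
      define k where "k = (LEAST k. (E ^^ k) x = 0)"
      have k: "(E ^^ k) x = 0" unfolding k_def by (rule LeastI_ex[OF ex])
      then obtain l where l: "k = Suc l" using \<open>x \<noteq> 0\<close> by (cases k) auto
      define y where "y = (E ^^ l) x"
      have y: "y \<noteq> 0" "E y = 0"
        using not_less_Least[of l "\<lambda>k. (E ^^ k) x = 0"] k by (simp_all add: l y_def flip: k_def)
      have yU: "y \<in> U" unfolding y_def using stable[OF x, of "gen UE ^ l"] by (simp add: act_power)
      then obtain a where "y = act a w" using U by auto
      then obtain c where c: "y = c \<star> w" using E_kernel y(2) by metis
      then have "c \<noteq> 0" using y(1) by auto
      then have "w = inverse c \<star> y" by (simp add: c)
      then show False using stable[OF yU] w by metis
    qed
    moreover have "0 \<in> U" using U by (simp add: submodule_def)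
    ultimately show "U = {0}" by auto
  qed
qed

lemma is_VC_range:
  assumes "w \<noteq> 0"
  shows "is_VC q s act (range (\<lambda>a. act a w))"
  unfolding is_VC_def quotient_of_def
  using simple_submodule_range[OF assms] verma_ideal_act
  by (auto intro!: exI[of _ "\<lambda>a. act a w"] simp: act_add_left act_mult)

end


section \<open>Highest weight vectors over the oscillator algebra\<close>

lemma map_gens_U_ideal: "a \<in> U_ideal q \<Longrightarrow> map_gens AU a \<in> A_ideal q C"
proof -
  have A: "two_sided_ideal (A_ideal q C)" unfolding A_ideal_def by (rule two_sided_ideal_hull)
  have "U_ideal q \<subseteq> {a. map_gens AU a \<in> A_ideal q C}"
    unfolding U_ideal_def
  proof (rule hull_minimal)
    show "U_relators q \<subseteq> {a. map_gens AU a \<in> A_ideal q C}"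
      by (auto simp: A_ideal_def A_relators_def Let_def intro!: hull_inc)
    show "two_sided_ideal {a. map_gens AU a \<in> A_ideal q C}"
      using A by (auto simp: two_sided_ideal_def left_ideal_def map_gens_add map_gens_mult)
  qed
  then show "a \<in> U_ideal q \<Longrightarrow> map_gens AU a \<in> A_ideal q C" by auto
qed

lemma restrict_to_U_gen: "restrict_to_U act (gen g) = act (gen (AU g))"
  and restrict_to_U_const: "restrict_to_U act (const c) = act (const c)"
  by (simp_all add: restrict_to_U_def)

text \<open>Restriction to the quantum group gives a second module structure on the same space. The rewrites
  make its scalar multiplication and its generators coincide syntactically with those of \<open>act\<close>.\<close>

locale A_module = free_module act + q_param q
  for q :: "'k::field" and act :: "(agen, 'k) free_alg \<Rightarrow> 'v::ab_group_add \<Rightarrow> 'v" +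
  fixes C0 :: "(ugen, 'k) free_alg"
  assumes ideal_act: "a \<in> A_ideal q C0 \<Longrightarrow> act a v = 0"
begin

abbreviation "E \<equiv> act (gen (AU UE))"
abbreviation "F \<equiv> act (gen (AU UF))"
abbreviation "K \<equiv> act (gen (AU UK))"
abbreviation "Ki \<equiv> act (gen (AU UKi))"
abbreviation "X \<equiv> act (gen AX)"
abbreviation "Y \<equiv> act (gen AY)"

sublocale U: free_module "restrict_to_U act"
  rewrites "\<And>g. restrict_to_U act (gen g) = act (gen (AU g))"
    and "\<And>c. restrict_to_U act (const c) = act (const c)"
  by unfold_locales
    (auto simp: restrict_to_U_gen restrict_to_U_const left_module_def restrict_to_U_def map_gens_add
      map_gens_mult act_add_left act_add_right act_mult)

sublocale U: U_module_mod q "restrict_to_U act" "{0}"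
  rewrites "\<And>g. restrict_to_U act (gen g) = act (gen (AU g))"
    and "\<And>c. restrict_to_U act (const c) = act (const c)"
  by unfold_locales
    (auto simp: submodule_def act.zero restrict_to_U_def ideal_act map_gens_U_ideal restrict_to_U_gen restrict_to_U_const)

lemma relator_act: "a \<in> A_relators q C0 \<Longrightarrow> act a v = 0"
  by (rule ideal_act) (simp add: A_ideal_def hull_inc)

lemma E_X: "E (X v) = q \<star> X (E v)"
  and E_Y: "E (Y v) = X v + inverse q \<star> Y (E v)"
  and F_X: "F (X v) = Y (Ki v) + X (F v)"
  and F_Y: "F (Y v) = Y (F v)"
  and Y_X: "q \<star> Y (X v) - X (Y v) = restrict_to_U act C0 v"
  and K_X_Ki: "K (X (Ki v)) = q \<star> X v"
  and K_Y_Ki: "K (Y (Ki v)) = inverse q \<star> Y v"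
  using relator_act[of "gen (AU UE) * gen AX - const q * gen AX * gen (AU UE)" v]
    relator_act[of "gen (AU UE) * gen AY - (gen AX + const (inverse q) * gen AY * gen (AU UE))" v]
    relator_act[of "gen (AU UF) * gen AX - (gen AY * gen (AU UKi) + gen AX * gen (AU UF))" v]
    relator_act[of "gen (AU UF) * gen AY - gen AY * gen (AU UF)" v]
    relator_act[of "const q * gen AY * gen AX - gen AX * gen AY - map_gens AU C0" v]
    relator_act[of "gen (AU UK) * gen AX * gen (AU UKi) - const q * gen AX" v]
    relator_act[of "gen (AU UK) * gen AY * gen (AU UKi) - const (inverse q) * gen AY" v]
  by (simp_all add: A_relators_def Let_def act_diff_left act_add_left act_mult restrict_to_U_def)

lemma Ki_K: "Ki (K v) = v"
  and K_F: "K (F v) = (q powi (-2)) \<star> F (K v)"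
  and E_F: "E (F v) = F (E v) + (1 / (q - inverse q)) \<star> (K v - Ki v)"
  using U.Ki_K U.K_F U.E_F by (simp_all add: U.eqN_def)

lemma K_X: "K (X v) = q \<star> X (K v)" and K_Y: "K (Y v) = inverse q \<star> Y (K v)"
  using K_X_Ki[of "K v"] K_Y_Ki[of "K v"] by (simp_all add: Ki_K)

lemma Ki_weight: "K x = c \<star> x \<Longrightarrow> c \<noteq> 0 \<Longrightarrow> Ki x = inverse c \<star> x"
  using U.Ki_weight by (simp add: U.eqN_def)

lemma highest_weightI:
  "E w = 0 \<Longrightarrow> K w = s \<star> w \<Longrightarrow> s \<noteq> 0 \<Longrightarrow> highest_weight q (restrict_to_U act) w s"
  by unfold_locales (simp_all add: U.eqN_def restrict_to_U_gen restrict_to_U_const)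

lemma F_pow_0 [simp]: "(F ^^ i) 0 = 0"
  by (induction i) (simp_all add: act.zero)

lemma F_pow_add: "(F ^^ i) (x + y) = (F ^^ i) x + (F ^^ i) y"
  by (induction i) (simp_all add: act.add)

lemma F_pow_scale: "(F ^^ i) (c \<star> x) = c \<star> (F ^^ i) x"
  by (induction i) (simp_all add: gen_scale)

lemma Y_F_pow: "Y ((F ^^ i) x) = (F ^^ i) (Y x)"
  by (induction i) (simp_all add: F_Y[symmetric])

lemma K_F_pow:
  assumes "K u = c \<star> u"
  shows "K ((F ^^ i) u) = (q powi (- 2 * int i) * c) \<star> (F ^^ i) u"
proof (induction i)
  case (Suc i)
  have "K ((F ^^ Suc i) u) = (q powi (-2) * (q powi (- 2 * int i)) * c) \<star> F ((F ^^ i) u)"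
    using Suc by (simp add: K_F gen_scale mult.assoc)
  also have "q powi (-2) * q powi (- 2 * int i) = q powi (- 2 * int (Suc i))"
    using q_nz by (simp flip: power_int_add)
  finally show ?case by simp
qed (simp add: assms)

lemma K_Y_pow:
  assumes "K u = c \<star> u"
  shows "K ((Y ^^ i) u) = (q powi (- int i) * c) \<star> (Y ^^ i) u"
proof (induction i)
  case (Suc i)
  have "K ((Y ^^ Suc i) u) = (q powi (-1) * (q powi (- int i)) * c) \<star> Y ((Y ^^ i) u)"
    using Suc by (simp add: K_Y gen_scale mult.assoc)
  also have "q powi (-1) * q powi (- int i) = q powi (- int (Suc i))"
    using q_nz power_int_add[of q "- 1" "- int i"] by simp
  finally show ?case by simp
qed (simp add: assms)

text \<open>Each exchange of \<open>X\<close> and \<open>F\<close> leaves a term \<open>Y K\<^sup>-\<^sup>1\<close>, and \<open>K\<^sup>-\<^sup>1\<close> acts on \<open>F\<^sup>t u\<close> by \<open>c\<^sup>-\<^sup>1 q\<^sup>2\<^sup>t\<close>; this is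
  where the geometric sum comes from.\<close>

lemma X_F_pow:
  assumes "K u = c \<star> u" "c \<noteq> 0"
  shows "X ((F ^^ Suc i) u) =
    (F ^^ Suc i) (X u) - (inverse c * (\<Sum>t\<le>i. (q ^ 2) ^ t)) \<star> (F ^^ i) (Y u)"
proof (induction i)
  case 0
  show ?case using F_X[of u] Ki_weight[OF assms] by (simp add: gen_scale eq_diff_eq add.commute)
next
  case (Suc i)
  have inv: "inverse (q powi (- 2 * int (Suc i)) * c) = inverse c * (q ^ 2) ^ Suc i"
  proof -
    have "- 2 * int (Suc i) = - int (2 * Suc i)" by simp
    then have "inverse (q powi (- 2 * int (Suc i))) = q ^ (2 * Suc i)"
      by (simp only: power_int_minus power_int_of_nat inverse_inverse_eq)
    then show ?thesis
      unfolding inverse_mult_distrib power_mult by (simp only: mult.commute)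
  qed
  let ?y = "(F ^^ Suc i) u"
  have "Ki ?y = inverse (q powi (- 2 * int (Suc i)) * c) \<star> ?y"
    by (rule Ki_weight[OF K_F_pow[OF assms(1)]]) (simp add: q_nz assms(2))
  then have Ki: "Y (Ki ?y) = (inverse c * (q ^ 2) ^ Suc i) \<star> (F ^^ Suc i) (Y u)"
    unfolding inv by (simp only: gen_scale Y_F_pow)
  have "X (F ?y) = F (X ?y) - Y (Ki ?y)" using F_X[of ?y] by simp
  also have "\<dots> = (F ^^ Suc (Suc i)) (X u) - ((inverse c * (\<Sum>t\<le>i. (q ^ 2) ^ t)) \<star> (F ^^ Suc i) (Y u) +
      (inverse c * (q ^ 2) ^ Suc i) \<star> (F ^^ Suc i) (Y u))"
    unfolding Suc Ki by (simp add: act.diff gen_scale diff_diff_eq)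
  also have "\<dots> = (F ^^ Suc (Suc i)) (X u) - (inverse c * (\<Sum>t\<le>Suc i. (q ^ 2) ^ t)) \<star> (F ^^ Suc i) (Y u)"
    by (simp only: scale_left_distrib[symmetric] distrib_left sum.atMost_Suc)
  finally show ?case by simp
qed


text \<open>The submodule generated by a singular vector \<open>w\<close> is spanned by the \<open>F\<^sup>i Y\<^sup>b w\<close>. The number of
  factors \<open>Y\<close> filters it: moving \<open>X\<close> past \<open>Y\<close> produces \<open>C\<^sub>0\<close>, which lies in the quantum group and
  does not raise that number.\<close>

definition FY_span :: "'v \<Rightarrow> nat \<Rightarrow> 'v set" where
  "FY_span w b = span {(F ^^ i) ((Y ^^ j) w) | i j. j \<le> b}"

lemma FY_span_mono: "b \<le> b' \<Longrightarrow> FY_span w b \<subseteq> FY_span w b'"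
  unfolding FY_span_def by (rule span_mono) fastforce

lemma subspace_FY_span: "subspace (FY_span w b)"
  unfolding FY_span_def by (rule subspace_span)

lemma FY_span_base: "j \<le> b \<Longrightarrow> (F ^^ i) ((Y ^^ j) w) \<in> FY_span w b"
  unfolding FY_span_def by (rule span_base) auto

lemma FY_span_act:
  assumes "\<And>i j. j \<le> b \<Longrightarrow> act a ((F ^^ i) ((Y ^^ j) w)) \<in> FY_span w b'" "x \<in> FY_span w b"
  shows "act a x \<in> FY_span w b'"
  using assms(2) unfolding FY_span_def
  by (rule act_span[rotated]) (use assms(1) in \<open>auto simp: FY_span_def\<close>)

lemma F_FY_span: "x \<in> FY_span w b \<Longrightarrow> F x \<in> FY_span w b"
  using FY_span_base[of _ b "Suc i" w for i] by (elim FY_span_act[rotated]) simp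

lemma Y_FY_span: "x \<in> FY_span w b \<Longrightarrow> Y x \<in> FY_span w (Suc b)"
  using FY_span_base[of "Suc j" "Suc b" _ w for j] by (elim FY_span_act[rotated]) (simp add: Y_F_pow)

context
  fixes w :: 'v and s :: 'k
  assumes w: "E w = 0" "X w = 0" "K w = s \<star> w" and s_nz: "s \<noteq> 0"
begin

lemma K_FY: "K ((F ^^ i) ((Y ^^ j) w)) = (q powi (- 2 * int i) * (q powi (- int j) * s)) \<star> (F ^^ i) ((Y ^^ j) w)"
  by (rule K_F_pow[OF K_Y_pow[OF w(3)]])

lemma K_FY_span: "x \<in> FY_span w b \<Longrightarrow> K x \<in> FY_span w b"
  by (elim FY_span_act[rotated]) (simp only: K_FY subspace_scale[OF subspace_FY_span] FY_span_base)

lemma Ki_FY_span: "x \<in> FY_span w b \<Longrightarrow> Ki x \<in> FY_span w b"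
proof (elim FY_span_act[rotated])
  fix i j assume "j \<le> b"
  have "Ki ((F ^^ i) ((Y ^^ j) w)) =
      inverse (q powi (- 2 * int i) * (q powi (- int j) * s)) \<star> (F ^^ i) ((Y ^^ j) w)"
    by (rule Ki_weight[OF K_FY]) (simp add: q_nz s_nz)
  then show "Ki ((F ^^ i) ((Y ^^ j) w)) \<in> FY_span w b"
    using \<open>j \<le> b\<close> by (simp only: subspace_scale[OF subspace_FY_span] FY_span_base)
qed

lemma E_FY_span:
  assumes "\<And>j. j \<le> b \<Longrightarrow> E ((Y ^^ j) w) \<in> FY_span w b" "x \<in> FY_span w b"
  shows "E x \<in> FY_span w b"
  using assms(2)
proof (elim FY_span_act[rotated])
  fix i j assume "j \<le> b"
  then show "E ((F ^^ i) ((Y ^^ j) w)) \<in> FY_span w b"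
  proof (induction i)
    case (Suc i)
    let ?x = "(F ^^ i) ((Y ^^ j) w)"
    have x: "?x \<in> FY_span w b" using Suc(2) by (rule FY_span_base)
    have "F (E ?x) + (1 / (q - inverse q)) \<star> (K ?x - Ki ?x) \<in> FY_span w b"
      by (intro subspace_add[OF subspace_FY_span] subspace_scale[OF subspace_FY_span]
          subspace_diff[OF subspace_FY_span] F_FY_span K_FY_span Ki_FY_span x Suc)
    then show ?case by (simp add: E_F)
  qed (use assms(1) in simp)
qed

text \<open>The induction hypothesis for \<open>a < b\<close> makes \<open>FY_span w a\<close> stable under the quantum group. This
  controls the term \<open>C\<^sub>0 Y\<^sup>a w\<close> that appears in \<open>X Y\<^sup>a\<^sup>+\<^sup>1 w\<close>.\<close>

lemma E_X_Y_pow: "E ((Y ^^ b) w) \<in> FY_span w b \<and> X ((Y ^^ b) w) \<in> FY_span w b"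
proof (induction b rule: less_induct)
  case (less b)
  show ?case
  proof (cases b)
    case 0
    then show ?thesis using w by (simp add: subspace_0[OF subspace_FY_span])
  next
    case (Suc a)
    let ?y = "(Y ^^ a) w"
    have y: "?y \<in> FY_span w a" using FY_span_base[of a a 0 w] by simp
    have E_le: "E ((Y ^^ j) w) \<in> FY_span w a" if "j \<le> a" for j
      using less[of j] that FY_span_mono[OF that] Suc by auto
    have "submodule (restrict_to_U act) (FY_span w a)"
      unfolding U.submodule_iff_subspace
    proof (intro conjI allI ballI)
      fix g x assume "x \<in> FY_span w a"
      then show "act (gen (AU g)) x \<in> FY_span w a"
        by (cases g) (simp_all add: F_FY_span K_FY_span Ki_FY_span E_FY_span[OF E_le])
    qed (rule subspace_FY_span)
    then have C: "restrict_to_U act C0 ?y \<in> FY_span w a"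
      using y by (simp add: submodule_def)
    have IH: "E ?y \<in> FY_span w a" "X ?y \<in> FY_span w a" using less[of a] Suc by auto
    have "X (Y ?y) = q \<star> Y (X ?y) - restrict_to_U act C0 ?y"
      by (simp flip: Y_X)
    also have "\<dots> \<in> FY_span w b"
      using FY_span_mono[of a b w] C Suc
      by (intro subspace_diff[OF subspace_FY_span] subspace_scale[OF subspace_FY_span])
        (auto intro: Y_FY_span IH)
    finally have 1: "X (Y ?y) \<in> FY_span w b" .
    have "E (Y ?y) = X ?y + inverse q \<star> Y (E ?y)" by (rule E_Y)
    also have "\<dots> \<in> FY_span w b"
      using FY_span_mono[of a b w] Suc IH
      by (intro subspace_add[OF subspace_FY_span] subspace_scale[OF subspace_FY_span])
        (auto intro: Y_FY_span)
    finally show ?thesis using 1 Suc by simp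
  qed
qed

lemma X_FY_span: "x \<in> FY_span w b \<Longrightarrow> X x \<in> FY_span w (Suc b)"
proof (elim FY_span_act[rotated])
  fix i j assume "j \<le> b"
  then show "X ((F ^^ i) ((Y ^^ j) w)) \<in> FY_span w (Suc b)"
  proof (induction i)
    case 0
    then show ?case using E_X_Y_pow[of j] FY_span_mono[of j "Suc b"] by auto
  next
    case (Suc i)
    let ?x = "(F ^^ i) ((Y ^^ j) w)"
    have "F (X ?x) - Y (Ki ?x) \<in> FY_span w (Suc b)"
      by (intro subspace_diff[OF subspace_FY_span] F_FY_span Y_FY_span Ki_FY_span FY_span_base Suc)
    then show ?case by (simp add: F_X)
  qed
qed

lemma submodule_FY_span: "submodule act (\<Union>b. FY_span w b)"
  unfolding submodule_iff_subspace
proof (intro conjI allI ballI)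
  have mono: "x \<in> FY_span w (max b b')" if "x \<in> FY_span w b \<or> x \<in> FY_span w b'" for x b b'
    using that FY_span_mono[of b "max b b'" w] FY_span_mono[of b' "max b b'" w] by auto
  show "subspace (\<Union>b. FY_span w b)"
    unfolding subspace_def
  proof (intro conjI ballI allI)
    show "0 \<in> (\<Union>b. FY_span w b)" using subspace_0[OF subspace_FY_span] by blast
    show "x + y \<in> (\<Union>b. FY_span w b)" if xy: "x \<in> (\<Union>b. FY_span w b)" "y \<in> (\<Union>b. FY_span w b)" for x y
    proof -
      obtain b b' where "x \<in> FY_span w b" "y \<in> FY_span w b'" using xy by auto
      then have "x + y \<in> FY_span w (max b b')"
        by (intro subspace_add[OF subspace_FY_span] mono) auto
      then show ?thesis by blast
    qed
    show "c \<star> x \<in> (\<Union>b. FY_span w b)" if x: "x \<in> (\<Union>b. FY_span w b)" for c x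
      using x subspace_scale[OF subspace_FY_span] by blast
  qed
  fix g x assume "x \<in> (\<Union>b. FY_span w b)"
  then obtain b where b: "x \<in> FY_span w b" by auto
  have E: "E ((Y ^^ j) w) \<in> FY_span w b" if "j \<le> b" for j
    using E_X_Y_pow[of j] FY_span_mono[OF that] by auto
  show "act (gen g) x \<in> (\<Union>b. FY_span w b)"
  proof (cases g)
    case (AU u)
    then show ?thesis
      using F_FY_span[OF b] K_FY_span[OF b] Ki_FY_span[OF b] E_FY_span[OF E b] by (cases u) auto
  qed (use X_FY_span[OF b] Y_FY_span[OF b] in auto)
qed

text \<open>The weights of the spanning vectors are the \<open>q\<^sup>-\<^sup>n s\<close> with \<open>n \<ge> 0\<close>. A vector \<open>x\<close> of a higher weight
  would be a sum of eigenvectors with eigenvalues other than its own.\<close>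

lemma singular_lower_weights:
  assumes "x \<in> (\<Union>b. FY_span w b)" "K x = (q powi int t * s) \<star> x" "t > 0"
  shows "x = 0"
proof -
  let ?\<mu> = "\<lambda>n. q powi (- n) * s"
  let ?S = "\<lambda>n. {y. K y = ?\<mu> n \<star> y}"
  have inj: "inj_on ?\<mu> A" for A using s_nz by (auto simp: inj_on_def powi_inject)
  obtain b where "x \<in> FY_span w b" using assms(1) by auto
  moreover have "{(F ^^ i) ((Y ^^ j) w) | i j. j \<le> b} \<subseteq> (\<Union>n\<in>{0..}. ?S n)"
  proof safe
    fix i j
    have "q powi (- 2 * int i) * (q powi (- int j) * s) = ?\<mu> (int (2 * i + j))"
      using q_nz by (simp add: algebra_simps flip: power_int_add)
    then have "(F ^^ i) ((Y ^^ j) w) \<in> ?S (int (2 * i + j))" using K_FY[of i j] by simp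
    then show "(F ^^ i) ((Y ^^ j) w) \<in> (\<Union>n\<in>{0..}. ?S n)"
      by (rule UN_I[rotated]) simp
  qed
  ultimately have "x \<in> span (\<Union>n\<in>{0..}. ?S n)"
    unfolding FY_span_def using span_mono by blast
  then obtain I f where I: "finite I" "I \<subseteq> {0..}" "\<forall>n\<in>I. f n \<in> span (?S n)" "x = (\<Sum>n\<in>I. f n)"
    using span_UN_sum[of x ?S "{0..}"] by auto
  have sub: "subspace (?S n)" for n
    by (auto simp: subspace_def act_add_right scale_right_distrib gen_scale act.zero mult.commute)
  then have f: "K (f n) = ?\<mu> n \<star> f n" if "n \<in> I" for n
    using I(3) that span_eq_iff[THEN iffD2, OF sub] by blast
  \<comment> \<open>The equation \<open>x = \<Sum> f n\<close> becomes a vanishing sum of eigenvectors; \<open>- t\<close> is the index for which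
    \<open>?\<mu>\<close> is the weight of \<open>x\<close>.\<close>
  define g where "g n = (if n = - int t then - x else f n)" for n
  have t: "- int t \<notin> I" using I(2) assms(3) by auto
  have "g (- int t) = 0"
  proof (rule eigenvectors_sum_0[of "insert (- int t) I" ?\<mu> "gen (AU UK)" g])
    show "K (g i) = ?\<mu> i \<star> g i" if "i \<in> insert (- int t) I" for i
      using that t f[of i] assms(2) by (auto simp: g_def act.neg)
    have "(\<Sum>n\<in>I. g n) = (\<Sum>n\<in>I. f n)" using t by (intro sum.cong) (auto simp: g_def)
    then show "(\<Sum>n\<in>insert (- int t) I. g n) = 0" using t I(1,4) by (simp add: g_def)
  qed (use I(1) inj in auto)
  then show ?thesis by (simp add: g_def)
qed

end

end


section \<open>The simple module of highest weight r\<close>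

locale simple_highest_weight = A_module q act C0
  for q :: "'k::field" and act :: "(agen, 'k) free_alg \<Rightarrow> 'v::ab_group_add \<Rightarrow> 'v" and C0 +
  fixes v :: 'v and r :: 'k
  assumes r_nz: "r \<noteq> 0" and v_nz: "v \<noteq> 0"
    and E_v: "E v = 0" and X_v: "X v = 0" and K_v: "K v = r \<star> v"
    and simple: "simple_submodule act UNIV" and central: "central_in_U q C0"
begin

definition wt :: "nat \<Rightarrow> 'k" where
  "wt j = q powi (- int j) * r"

lemma wt_0 [simp]: "wt 0 = r"
  by (simp add: wt_def)

lemma q_wt_Suc: "q * wt (Suc j) = wt j"
  using q_nz power_int_add[of q 1 "- 1 - int j"] by (simp add: wt_def)

lemma wt_nz [simp]: "wt j \<noteq> 0"
  by (simp add: wt_def q_nz r_nz)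

lemma inj_wt: "inj wt"
  by (rule injI) (simp add: wt_def powi_inject r_nz)

lemma alpha_2: "alpha q C0 r (Suc (Suc 0)) = qbrace q (q * wt 0) * c_scalar q C0 (wt 0)"
  by (simp add: alpha_def)

lemma alpha_Suc:
  "alpha q C0 r (Suc (Suc (Suc j))) = alpha q C0 r (Suc (Suc j)) + qbrace q (q * wt (Suc j)) * c_scalar q C0 (wt (Suc j))"
proof -
  have eq: "q powi (1 - int i) * r = q * wt i" for i
    using q_nz power_int_add[of q 1 "- int i"] by (simp add: wt_def)
  have "alpha q C0 r (l + 2) = (\<Sum>i = 0..l. qbrace q (q * wt i) * c_scalar q C0 (wt i))" for l
    by (simp add: alpha_def eq flip: wt_def)
  from this[of j] this[of "Suc j"] show ?thesis by simp
qed

text \<open>Otherwise \<open>w\<close> generates the whole module, which contains \<open>v\<close>, a vector of a weight above that of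
  \<open>w\<close>.\<close>

lemma singular_eq_0:
  assumes "E w = 0" "X w = 0" "K w = (q powi (- int t) * r) \<star> w" "t > 0"
  shows "w = 0"
proof (rule ccontr)
  assume "w \<noteq> 0"
  have nz: "q powi (- int t) * r \<noteq> 0" using q_nz r_nz by simp
  have "w \<in> (\<Union>b. FY_span w b)" using FY_span_base[of 0 0 0 w] by auto
  with \<open>w \<noteq> 0\<close> have "(\<Union>b. FY_span w b) = UNIV"
    using submodule_FY_span[OF assms(1-3) nz] simple unfolding simple_submodule_def by blast
  moreover have "K v = (q powi int t * (q powi (- int t) * r)) \<star> v"
    using K_v q_nz by (simp add: power_int_minus)
  ultimately have "v = 0"
    using singular_lower_weights[OF assms(1-3) nz _ _ assms(4), of v] by blast
  then show False using v_nz by contradiction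
qed

text \<open>The highest weight vectors for the quantum group. As \<open>E Y w = X w\<close> and \<open>E F X w = {q s} X w\<close> for a
  highest weight vector \<open>w\<close> of weight \<open>s\<close>, the correction term makes \<open>E\<close> kill the next vector as long
  as the bracket does not vanish. Once a bracket vanishes, the division by zero drops the correction
  term, and the values are meaningless.\<close>

primrec hv :: "nat \<Rightarrow> 'v" where
  "hv 0 = v"
| "hv (Suc j) = Y (hv j) - (1 / qbrace q (q * wt j)) \<star> F (X (hv j))"

lemma highest_weight_hv:
  assumes "\<And>i. i < j \<Longrightarrow> qbrace q (q * wt i) \<noteq> 0"
  shows "K (hv j) = wt j \<star> hv j \<and> E (hv j) = 0"
  using assms
proof (induction j)
  case 0
  show ?case using K_v E_v by simp
next
  case (Suc j)
  then have IH: "K (hv j) = wt j \<star> hv j" "E (hv j) = 0" and nz: "qbrace q (q * wt j) \<noteq> 0" by auto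
  have KX: "K (X (hv j)) = (q * wt j) \<star> X (hv j)"
    by (simp add: K_X IH gen_scale)
  then have "Ki (X (hv j)) = inverse (q * wt j) \<star> X (hv j)"
    by (rule Ki_weight) (simp add: q_nz)
  then have "(1 / (q - inverse q)) \<star> (K (X (hv j)) - Ki (X (hv j))) = qbrace q (q * wt j) \<star> X (hv j)"
    by (simp add: KX qbrace_def flip: scale_left_diff_distrib)
  then have EFX: "E (F (X (hv j))) = qbrace q (q * wt j) \<star> X (hv j)"
    by (simp add: E_F E_X IH act.zero)
  have "E (hv (Suc j)) = 0"
    using nz by (simp add: act.diff gen_scale E_Y IH EFX act.zero)
  moreover have "K (hv (Suc j)) = wt (Suc j) \<star> hv (Suc j)"
  proof -
    have "inverse q * wt j = wt (Suc j)" using q_nz q_wt_Suc[of j, symmetric] by simp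
    moreover have "q powi (-2) * (q * wt j) = inverse q * wt j"
      using q_nz by (simp add: power_int_minus power2_eq_square field_simps)
    ultimately show ?thesis
      by (simp add: act.diff gen_scale K_Y K_F KX IH scale_right_diff_distrib mult.commute)
  qed
  ultimately show ?case by simp
qed

text \<open>Let \<open>X v\<^sub>j\<^sub>+\<^sub>1 = d v\<^sub>j\<close> and write \<open>X Y\<close> as \<open>q Y X - C\<^sub>0\<close> and \<open>X F\<close> as \<open>F X - Y K\<^sup>-\<^sup>1\<close> in \<open>X v\<^sub>j\<^sub>+\<^sub>2\<close>.
  The contributions of \<open>F X v\<^sub>j\<close> cancel, and \<open>v\<^sub>j\<^sub>+\<^sub>1\<close> gets the coefficient \<open>d b / b' - c\<close>, with
  consecutive brackets \<open>b\<close>, \<open>b'\<close> and the scalar \<open>c\<close> of \<open>C\<^sub>0\<close>. Multiplied by \<open>b'\<close>, this says that the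
  sequence of the \<open>d b\<close> changes by \<open>- b' c\<close> at each step, as does \<open>- \<alpha>\<close>.\<close>

lemma X_hv_Suc:
  assumes "\<And>i. i \<le> j \<Longrightarrow> qbrace q (q * wt i) \<noteq> 0"
  shows "X (hv (Suc j)) = (- alpha q C0 r (Suc (Suc j)) / qbrace q (q * wt j)) \<star> hv j"
  using assms
proof (induction j)
  case 0
  interpret H: highest_weight q "restrict_to_U act" v r
    using highest_weightI E_v K_v r_nz by blast
  have "X (Y v) = - restrict_to_U act C0 v"
    using Y_X[of v] by (simp add: X_v act.zero flip: Y_X)
  also have "restrict_to_U act C0 v = c_scalar q C0 r \<star> v"
    using H.central_act[OF central] by (simp add: restrict_to_U_const)
  finally show ?case using 0[of 0] by (simp add: X_v act.zero alpha_2)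
next
  case (Suc j)
  define b b' d c where "b = qbrace q (q * wt j)" and "b' = qbrace q (wt j)"
    and "d = - alpha q C0 r (Suc (Suc j)) / b" and "c = c_scalar q C0 (wt (Suc j))"
  have nz: "b \<noteq> 0" "b' \<noteq> 0" using Suc.prems[of j] Suc.prems[of "Suc j"] by (simp_all add: b_def b'_def q_wt_Suc)
  have IH: "X (hv (Suc j)) = d \<star> hv j" using Suc by (simp add: d_def b_def)
  have Kj: "K (hv j) = wt j \<star> hv j" using highest_weight_hv[of j] Suc.prems by auto
  have "K (hv (Suc j)) = wt (Suc j) \<star> hv (Suc j)" "E (hv (Suc j)) = 0"
    using highest_weight_hv[of "Suc j"] Suc.prems by auto
  then interpret H: highest_weight q "restrict_to_U act" "hv (Suc j)" "wt (Suc j)"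
    by (intro highest_weightI) auto
  have C: "restrict_to_U act C0 (hv (Suc j)) = c \<star> hv (Suc j)"
    using H.central_act[OF central] by (simp add: restrict_to_U_const c_def)
  have Ki: "Ki (hv j) = inverse (wt j) \<star> hv j" by (rule Ki_weight[OF Kj]) simp
  have Y: "Y (hv j) = hv (Suc j) + (1 / b) \<star> F (X (hv j))" by (simp add: b_def)
  have XF: "X (F (hv j)) = F (X (hv j)) - inverse (wt j) \<star> Y (hv j)"
    using F_X[of "hv j"] by (simp add: Ki gen_scale)
  \<comment> \<open>The identity behind the cancellation: it compares the brackets of \<open>wt j\<close> and \<open>q * wt j\<close>.\<close>
  have b_b': "q * b' - b + inverse (wt j) = 0"
  proof -
    have "(q * b' - b) * (q - inverse q) = - inverse (wt j) * (q - inverse q)"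
    proof -
      have "b' * (q - inverse q) = wt j - inverse (wt j)"
        "b * (q - inverse q) = q * wt j - inverse q * inverse (wt j)"
        using q_diff_nz by (simp_all add: b_def b'_def qbrace_def)
      then show ?thesis by algebra
    qed
    then have "q * b' - b = - inverse (wt j)" by (rule mult_right_cancel[OF q_diff_nz, THEN iffD1])
    then show ?thesis by simp
  qed
  have "X (hv (Suc (Suc j))) = X (Y (hv (Suc j))) - (1 / b') \<star> X (F (X (hv (Suc j))))"
    unfolding hv.simps(2)[of "Suc j"] q_wt_Suc by (simp only: act.diff gen_scale b'_def)
  also have "X (Y (hv (Suc j))) = (q * d) \<star> Y (hv j) - c \<star> hv (Suc j)"
    using Y_X[of "hv (Suc j)"] by (simp only: IH C gen_scale scale_scale) (simp add: algebra_simps)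
  also have "(q * d) \<star> Y (hv j) - c \<star> hv (Suc j) - (1 / b') \<star> X (F (X (hv (Suc j)))) =
      (q * d) \<star> Y (hv j) - c \<star> hv (Suc j) - (d / b') \<star> (F (X (hv j)) - inverse (wt j) \<star> Y (hv j))"
    by (simp only: IH gen_scale XF scale_scale) simp
  also have "\<dots> = (q * d + d * inverse (wt j) / b') \<star> Y (hv j) - c \<star> hv (Suc j) - (d / b') \<star> F (X (hv j))"
    by (simp add: scale_right_diff_distrib scale_left_distrib)
  also have "q * d + d * inverse (wt j) / b' = d * b / b'"
  proof -
    have "q * d + d * inverse (wt j) / b' - d * b / b' = d * (q * b' - b + inverse (wt j)) / b'"
      using nz by (simp add: algebra_simps add_divide_distrib diff_divide_distrib)
    then show ?thesis by (simp add: b_b')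
  qed
  also have "(d * b / b') \<star> Y (hv j) - c \<star> hv (Suc j) - (d / b') \<star> F (X (hv j)) =
      (d * b / b' - c) \<star> hv (Suc j)"
    unfolding Y using nz by (simp add: scale_right_distrib scale_left_diff_distrib del: hv.simps)
  also have "d * b / b' - c = - alpha q C0 r (Suc (Suc (Suc j))) / b'"
    using nz alpha_Suc[of j] by (simp add: d_def c_def b'_def q_wt_Suc field_simps)
  finally show ?case by (simp only: b'_def q_wt_Suc)
qed


lemma alpha_eq_0:
  assumes "\<And>i. i \<le> j \<Longrightarrow> qbrace q (q * wt i) \<noteq> 0" "hv j \<noteq> 0" "hv (Suc j) = 0"
  shows "alpha q C0 r (Suc (Suc j)) = 0"
proof -
  have "(- alpha q C0 r (Suc (Suc j)) / qbrace q (q * wt j)) \<star> hv j = X (hv (Suc j))"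
    by (rule X_hv_Suc[symmetric]) (rule assms(1))
  also have "\<dots> = 0" by (simp only: assms(3) act.zero)
  finally have "(- alpha q C0 r (Suc (Suc j)) / qbrace q (q * wt j)) \<star> hv j = 0" .
  then show ?thesis using assms(1)[of j] assms(2) by auto
qed

lemma wt_dominant:
  assumes "r = q ^ n \<or> r = - (q ^ n)" "j \<le> n"
  shows "wt j = q ^ (n - j) \<or> wt j = - (q ^ (n - j))"
proof -
  have "q ^ n = q ^ j * q ^ (n - j)" using assms(2) by (simp flip: power_add)
  then show ?thesis using assms(1) q_nz by (auto simp: wt_def power_int_minus)
qed

lemma qbrace_wt_nz:
  assumes "r = q ^ n \<or> r = - (q ^ n)" "j \<le> n"
  shows "qbrace q (q * wt j) \<noteq> 0"
proof
  assume "qbrace q (q * wt j) = 0"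
  then have "(q * wt j) ^ 2 = 1" using qbrace_eq_0_iff[of "q * wt j"] q_nz by auto
  moreover have "(wt j) ^ 2 = (q ^ (n - j)) ^ 2"
    using wt_dominant[OF assms] by auto
  then have "(q * wt j) ^ 2 = q ^ (Suc (n - j) * 2)"
    by (simp only: power_mult power_mult_distrib power_Suc)
  ultimately show False using not_root by (metis nat_0_less_mult_iff zero_less_Suc zero_less_numeral)
qed

text \<open>The weight of \<open>hv (Suc n)\<close> is \<open>q\<^sup>-\<^sup>1\<close> or \<open>- q\<^sup>-\<^sup>1\<close>, which no finite-dimensional module admits as a
  highest weight. So that vector is zero, and \<open>\<alpha>\<close> vanishes where the sequence first breaks off.\<close>

lemma finite_dim_imp_alpha_zero:
  assumes "finite B" "span B = UNIV"
  shows "\<exists>n p. (r = q ^ n \<or> r = - (q ^ n)) \<and> p \<le> n \<and> least_alpha_zero q C0 r (p + 2)"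
proof -
  have weight: "\<exists>n. s = q ^ n \<or> s = - (q ^ n)" if w: "E w = 0" "K w = s \<star> w" "s \<noteq> 0" "w \<noteq> 0" for w s
  proof -
    interpret H: highest_weight q "restrict_to_U act" w s
      using w by (intro highest_weightI)
    show ?thesis using H.finite_dim_weight[of B] assms w(4) by (simp add: restrict_to_U_const)
  qed
  obtain n where n: "r = q ^ n \<or> r = - (q ^ n)" using weight[OF E_v K_v r_nz v_nz] by blast
  have nz: "qbrace q (q * wt i) \<noteq> 0" if "i \<le> n" for i using qbrace_wt_nz[OF n that] .
  have "hv (Suc n) = 0"
  proof (rule ccontr)
    assume "hv (Suc n) \<noteq> 0"
    then obtain l where "wt (Suc n) = q ^ l \<or> wt (Suc n) = - (q ^ l)"
      using weight[of "hv (Suc n)" "wt (Suc n)"] highest_weight_hv[of "Suc n"] nz by auto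
    then have "(wt (Suc n)) ^ 2 = (q ^ l) ^ 2" by auto
    moreover have "(q * wt (Suc n)) ^ 2 = (q ^ (n - n)) ^ 2"
      using wt_dominant[OF n, of n] unfolding q_wt_Suc by auto
    ultimately have "q ^ (Suc l * 2) = 1" 
      by (simp only: power_mult_distrib power_mult power_Suc diff_self_eq_0 power_0 power_one)
    then show False using not_root by (metis nat_0_less_mult_iff zero_less_Suc zero_less_numeral)
  qed
  moreover have "hv 0 \<noteq> 0" using v_nz by simp
  ultimately obtain j where j: "j \<le> n" "hv j \<noteq> 0" "hv (Suc j) = 0"
  proof (induction n arbitrary: thesis)
    case (Suc n)
    show ?case
    proof (cases "hv (Suc n) = 0")
      case True
      then show ?thesis using Suc.IH[of thesis] Suc.prems(1,3) by (meson le_SucI)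
    next
      case False
      then show ?thesis using Suc.prems(1)[of "Suc n"] Suc.prems(2) by blast
    qed
  qed simp
  have a: "alpha q C0 r (Suc (Suc j)) = 0" using j nz by (intro alpha_eq_0) auto
  let ?P = "\<lambda>l. 1 < l \<and> alpha q C0 r l = 0"
  define l where "l = (LEAST l. ?P l)"
  have P: "?P (Suc (Suc j))" using a by simp
  then have l: "?P l" unfolding l_def by (rule LeastI)
  then have eq: "l - 2 + 2 = l" by linarith
  have l_le: "l \<le> l'" if "?P l'" for l' unfolding l_def using that by (rule Least_le)
  have "least_alpha_zero q C0 r (l - 2 + 2)"
    unfolding eq using l l_le by (auto simp: least_alpha_zero_def)
  moreover have "l - 2 \<le> n" using l_le[OF P] j(1) by simp
  ultimately show ?thesis using n by blast
qed

end

locale dominant_highest_weight = simple_highest_weight q act C0 v r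
  for q :: "'k::field" and act :: "(agen, 'k) free_alg \<Rightarrow> 'v::ab_group_add \<Rightarrow> 'v" and C0 v r +
  fixes n p :: nat
  assumes r_dominant: "r = q ^ n \<or> r = - (q ^ n)" and p_le: "p \<le> n"
    and alpha_zero: "least_alpha_zero q C0 r (p + 2)"
begin

lemma bracket_nz: "i \<le> p \<Longrightarrow> qbrace q (q * wt i) \<noteq> 0"
  using qbrace_wt_nz[OF r_dominant] p_le by simp

lemma hv_weight: "j \<le> Suc p \<Longrightarrow> K (hv j) = wt j \<star> hv j" and E_hv: "j \<le> Suc p \<Longrightarrow> E (hv j) = 0"
  using highest_weight_hv[of j] bracket_nz by auto

lemma hv_nz: "j \<le> p \<Longrightarrow> hv j \<noteq> 0"
proof (induction j)
  case (Suc j)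
  show ?case
  proof
    assume "hv (Suc j) = 0"
    then have "alpha q C0 r (Suc (Suc j)) = 0"
      using Suc bracket_nz by (intro alpha_eq_0) auto
    then have "p + 2 \<le> Suc (Suc j)" using alpha_zero by (auto simp: least_alpha_zero_def)
    then show False using Suc.prems by simp
  qed
qed (simp add: v_nz)

lemma hv_Suc_p: "hv (Suc p) = 0"
proof (rule singular_eq_0)
  show "X (hv (Suc p)) = 0"
    using X_hv_Suc[of p] bracket_nz alpha_zero by (simp add: least_alpha_zero_def del: hv.simps)
  show "K (hv (Suc p)) = (q powi (- int (Suc p)) * r) \<star> hv (Suc p)"
    using hv_weight[of "Suc p"] by (simp only: wt_def)
qed (simp_all only: E_hv order_refl zero_less_Suc)

lemma highest_weight_hv_U: "j \<le> p \<Longrightarrow> highest_weight q (restrict_to_U act) (hv j) (wt j)"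
  by (rule highest_weightI) (simp_all add: hv_weight E_hv)

lemma Y_hv: "j \<le> p \<Longrightarrow> Y (hv j) = hv (Suc j) + (1 / qbrace q (q * wt j)) \<star> F (X (hv j))"
  by simp

text \<open>Downward induction on \<open>j\<close>: the vector is killed by \<open>E\<close> because the weight of \<open>hv j\<close> is
  \<open>q\<^sup>n\<^sup>-\<^sup>j\<close> up to sign. In its image under \<open>X\<close> the terms with \<open>X (hv j)\<close> cancel by
  \<open>geometric_sum_dominant\<close>, and what remains is a multiple of the vector for \<open>j + 1\<close>. So it is
  singular, of a weight below \<open>r\<close>.\<close>

lemma F_top_hv: "j \<le> Suc p \<Longrightarrow> (F ^^ (Suc n - j)) (hv j) = 0"
proof (induction rule: inc_induct)
  case base
  show ?case by (simp only: hv_Suc_p F_pow_0)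
next
  case (step j)
  then have j: "j \<le> p" "j \<le> n" using p_le by simp_all
  define N where "N = n - j"
  have N: "Suc n - j = Suc N" "Suc n - Suc j = N" using j by (simp_all add: N_def)
  interpret H: highest_weight q "restrict_to_U act" "hv j" "wt j"
    using highest_weight_hv_U j by blast
  have wtN: "wt j = q ^ N \<or> wt j = - (q ^ N)" unfolding N_def by (rule wt_dominant[OF r_dominant j(2)])
  show ?case unfolding N
  proof (rule singular_eq_0)
    show "E ((F ^^ Suc N) (hv j)) = 0"
      using H.E_F_pow_Suc[of N] EF_coeff_eq_0_iff[of "wt j" N] wtN
      by (simp add: restrict_to_U_gen restrict_to_U_const del: funpow.simps)
    have "(F ^^ N) (Y (hv j)) = (1 / qbrace q (q * wt j)) \<star> (F ^^ Suc N) (X (hv j))"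
      unfolding Y_hv[OF j(1)] F_pow_add F_pow_scale
      using step.IH unfolding N by (simp add: funpow_swap1 del: hv.simps)
    then show "X ((F ^^ Suc N) (hv j)) = 0"
      unfolding X_F_pow[OF hv_weight wt_nz, of j, OF le_SucI[OF j(1)]] geometric_sum_dominant[OF wtN]
      using bracket_nz[OF j(1)] by (simp del: funpow.simps)
    have "q powi (- 2 * int (Suc N)) * wt j = q powi (- int (2 * Suc N + j)) * r"
    proof -
      have "- int (2 * Suc N + j) = - 2 * int (Suc N) + - int j" by simp
      then show ?thesis
        by (simp only: wt_def power_int_add[OF disjI1[OF q_nz]] mult.assoc)
    qed
    then show "K ((F ^^ Suc N) (hv j)) = (q powi (- int (2 * Suc N + j)) * r) \<star> (F ^^ Suc N) (hv j)"
      using K_F_pow[OF hv_weight[of j], of "Suc N"] j(1) by (simp only: le_SucI)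
  qed simp
qed

lemma finite_highest_weight_hv:
  assumes "j \<le> p"
  shows "finite_highest_weight q (restrict_to_U act) (hv j) (wt j) (n - j)"
proof -
  interpret H: highest_weight q "restrict_to_U act" "hv j" "wt j"
    using highest_weight_hv_U assms by blast
  have "Suc (n - j) = Suc n - j" using assms p_le by simp
  then show ?thesis
    using wt_dominant[OF r_dominant, of j] F_top_hv[of j] assms p_le
    by unfold_locales (auto simp: restrict_to_U_gen simp del: funpow.simps)
qed

definition W :: "nat \<Rightarrow> 'v set" where
  "W j = range (\<lambda>a. restrict_to_U act a (hv j))"

lemma is_VC_W: "j \<le> p \<Longrightarrow> is_VC q (wt j) (restrict_to_U act) (W j)"
  unfolding W_def by (rule finite_highest_weight.is_VC_range[OF finite_highest_weight_hv hv_nz])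

lemma submodule_W: "submodule (restrict_to_U act) (W j)"
  unfolding W_def by (rule U.submodule_range)

lemma W_act: "x \<in> W j \<Longrightarrow> restrict_to_U act a x \<in> W j"
  using submodule_W by (simp add: submodule_def)

lemma subspace_W: "subspace (W j)"
  using submodule_W U.submodule_iff_subspace by blast

definition F_hv :: "nat \<Rightarrow> 'v set" where
  "F_hv j = range (\<lambda>i. (F ^^ i) (hv j))"

lemma F_hv_W: "F_hv j \<subseteq> W j"
proof -
  have "hv j \<in> W j" unfolding W_def by (rule range_eqI[of _ _ 1]) simp
  then have "(F ^^ i) (hv j) \<in> W j" for i
    by (induction i) (use W_act[of _ j "gen UF"] in \<open>auto simp: restrict_to_U_gen\<close>)
  then show ?thesis by (auto simp: F_hv_def)
qed

lemma finite_F_hv: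
  assumes "j \<le> p" shows "finite (F_hv j)"
proof -
  interpret H: finite_highest_weight q "restrict_to_U act" "hv j" "wt j" "n - j"
    using finite_highest_weight_hv assms .
  have "F_hv j \<subseteq> insert 0 ((\<lambda>i. (F ^^ i) (hv j)) ` {..n - j})"
    unfolding F_hv_def using H.F_pow_eq_0 by (auto simp: restrict_to_U_gen) (meson atMost_iff imageI not_le)
  then show ?thesis by (rule finite_subset) simp
qed

lemma X_hv: "j \<le> p \<Longrightarrow> \<exists>c i. i \<le> p \<and> X (hv j) = c \<star> hv i"
proof (cases j)
  case 0
  then show ?thesis using X_v by (auto intro!: exI[of _ 0])
next
  case (Suc i)
  assume "j \<le> p"
  then have "X (hv (Suc i)) = (- alpha q C0 r (Suc (Suc i)) / qbrace q (q * wt i)) \<star> hv i"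
    using Suc by (intro X_hv_Suc bracket_nz) simp
  with \<open>j \<le> p\<close> Suc show ?thesis by (metis Suc_leD)
qed

text \<open>The operators \<open>X\<close> and \<open>Y\<close> lead from \<open>hv j\<close> to its neighbours only, and \<open>hv (Suc p) = 0\<close> closes the
  chain; so the span is a nonzero submodule of a simple module.\<close>

lemma span_F_hv: "span (\<Union>j\<in>{0..p}. F_hv j) = UNIV"
proof -
  let ?T = "span (\<Union>j\<in>{0..p}. F_hv j)"
  have base: "(F ^^ i) (hv j) \<in> ?T" if "j \<le> Suc p" for i j
  proof (cases "j = Suc p")
    case True
    then show ?thesis by (simp only: hv_Suc_p F_pow_0 span_zero)
  next
    case False
    then have "j \<in> {0..p}" using that by simp
    then show ?thesis by (intro span_base UN_I) (auto simp: F_hv_def)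
  qed
  have FX: "(F ^^ i) (X (hv j)) \<in> ?T" if j: "j \<le> p" for i j
  proof -
    obtain c l where "l \<le> p" "X (hv j) = c \<star> hv l" using X_hv[OF j] by auto
    then show ?thesis using base[of l i] by (simp add: F_pow_scale span_scale)
  qed
  have FY: "(F ^^ i) (Y (hv j)) \<in> ?T" if j: "j \<le> p" for i j
    unfolding Y_hv[OF j] F_pow_add F_pow_scale
    using base[of "Suc j" i] FX[OF j, of "Suc i"] j
    by (intro span_add span_scale) (simp_all add: funpow_swap1 del: hv.simps)
  have "submodule act ?T"
  proof (rule submodule_span)
    fix g x assume "x \<in> (\<Union>j\<in>{0..p}. F_hv j)"
    then obtain i j where j: "j \<le> p" and x: "x = (F ^^ i) (hv j)" by (auto simp: F_hv_def)
    interpret H: highest_weight q "restrict_to_U act" "hv j" "wt j"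
      using highest_weight_hv_U j by blast
    have b: "(F ^^ i) (hv j) \<in> ?T" for i using base j by simp
    note H = H.E_F_pow_Suc[unfolded H.eqN_iff_eq restrict_to_U_gen restrict_to_U_const]
      H.K_F_pow[unfolded H.eqN_iff_eq restrict_to_U_gen restrict_to_U_const]
      H.Ki_F_pow[unfolded H.eqN_iff_eq restrict_to_U_gen restrict_to_U_const]
    show "act (gen g) x \<in> ?T"
    proof (cases g)
      case (AU u)
      show ?thesis
      proof (cases u)
        case UE
        show ?thesis
        proof (cases i)
          case 0
          then show ?thesis using AU UE x E_hv[of j] j by (simp add: span_zero)
        next
          case (Suc k)
          then show ?thesis unfolding AU UE x Suc H(1) by (intro span_scale b)
        qed
      next
        case UF
        then show ?thesis using b[of "Suc i"] AU x by simp
      qed (unfold AU x, simp_all only: H span_scale[OF b])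
    next
      case AX
      show ?thesis
      proof (cases i)
        case 0
        then show ?thesis using AX x FX[OF j, of 0] by simp
      next
        case (Suc k)
        show ?thesis
          unfolding AX x Suc X_F_pow[OF hv_weight wt_nz, of j, OF le_SucI[OF j]]
          by (intro span_diff span_scale FX FY j)
      qed
    next
      case AY
      then show ?thesis using FY[OF j, of i] x by (simp add: Y_F_pow)
    qed
  qed
  moreover have "v \<in> ?T" using base[of 0 0] by simp
  ultimately show ?thesis
    using simple v_nz unfolding simple_submodule_def by blast
qed

lemma finite_dim_act: "finite_dim act"
  unfolding finite_dim_def using finite_F_hv
  by (intro finite_spanning_imp_finite_dim[OF _ span_F_hv]) auto

text \<open>The summands are independent: applying \<open>E\<close> reduces to the case where every summand is killed by
  \<open>E\<close>, that is, a multiple of \<open>hv j\<close>, and these have distinct weights.\<close>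

lemma W_independent:
  assumes "\<And>j. j \<in> {0..p} \<Longrightarrow> d j \<in> W j" "(\<Sum>j\<in>{0..p}. d j) = 0" "j \<in> {0..p}"
  shows "d j = 0"
proof -
  \<comment> \<open>Induction on a common exponent \<open>k\<close> with \<open>E\<^sup>k d\<^sub>j = 0\<close>; the hypothesis is applied to the \<open>E d\<^sub>j\<close>.\<close>
  have main: "d j = 0" if "\<And>j. j \<in> {0..p} \<Longrightarrow> d j \<in> W j" "(\<Sum>j\<in>{0..p}. d j) = 0"
    "\<And>j. j \<in> {0..p} \<Longrightarrow> (E ^^ k) (d j) = 0" "j \<in> {0..p}" for k d j
    using that
  proof (induction k arbitrary: d j)
    case (Suc k)
    have Ed: "E (d i) = 0" if i: "i \<in> {0..p}" for i
    proof (rule Suc.IH[of "\<lambda>j. E (d j)"])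
      show "E (d j) \<in> W j" if "j \<in> {0..p}" for j
        using W_act[OF Suc.prems(1)[OF that], of "gen UE"] by (simp add: restrict_to_U_gen)
      show "(\<Sum>j\<in>{0..p}. E (d j)) = 0"
        using Suc.prems(2) by (simp add: act.zero flip: act.sum)
      show "(E ^^ k) (E (d j)) = 0" if "j \<in> {0..p}" for j
        using Suc.prems(3)[OF that] by (simp add: funpow_swap1)
    qed (rule i)
    have "K (d i) = wt i \<star> d i" if i: "i \<in> {0..p}" for i
    proof -
      interpret H: finite_highest_weight q "restrict_to_U act" "hv i" "wt i" "n - i"
        using finite_highest_weight_hv i by simp
      obtain a where "d i = restrict_to_U act a (hv i)" using Suc.prems(1)[OF i] by (auto simp: W_def)
      then obtain c where "d i = c \<star> hv i"
        using H.E_kernel[of a] Ed[OF i] by (auto simp: restrict_to_U_gen restrict_to_U_const)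
      then show ?thesis using hv_weight[of i] i by (simp add: gen_scale mult.commute)
    qed
    then show ?case
      using eigenvectors_sum_0[of "{0..p}" wt "gen (AU UK)" d j] Suc.prems(2,4) inj_on_subset[OF inj_wt]
      by auto
  qed simp
  have "\<exists>k. (E ^^ k) (d j) = 0" if j: "j \<in> {0..p}" for j
  proof -
    interpret H: highest_weight q "restrict_to_U act" "hv j" "wt j"
      using highest_weight_hv_U j by simp
    show ?thesis using assms(1)[OF j] H.E_nilpotent by (auto simp: W_def restrict_to_U_gen)
  qed
  then obtain k where k: "\<And>j. j \<in> {0..p} \<Longrightarrow> (E ^^ k j) (d j) = 0" by metis
  have E0: "(E ^^ i) 0 = 0" for i by (induction i) (simp_all add: act.zero)
  have "(E ^^ Max (k ` {0..p})) (d j) = 0" if j: "j \<in> {0..p}" for j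
  proof -
    have "k j \<le> Max (k ` {0..p})" using j by simp
    then obtain l where "Max (k ` {0..p}) = l + k j" by (metis add.commute le_Suc_ex)
    then show ?thesis using k[OF j] E0 by (simp add: funpow_add)
  qed
  from main[OF assms(1,2) this assms(3)] show ?thesis by simp
qed

lemma direct_sum_W: "internal_direct_sum {0..p} W"
  unfolding internal_direct_sum_def
proof
  fix x
  have "x \<in> span (\<Union>j\<in>{0..p}. F_hv j)" by (simp add: span_F_hv)
  from span_UN_sum[OF this] obtain I f where I: "finite I" "I \<subseteq> {0..p}"
    "\<forall>j\<in>I. f j \<in> span (F_hv j)" "x = (\<Sum>j\<in>I. f j)"
    by (elim exE conjE)
  define g where "g j = (if j \<in> {0..p} then if j \<in> I then f j else 0 else undefined)" for j
  have fW: "f j \<in> W j" if "j \<in> I" for j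
    using I(3) that span_minimal[OF F_hv_W subspace_W] by blast
  have g: "g \<in> (\<Pi>\<^sub>E j\<in>{0..p}. W j)"
    using fW subspace_0[OF subspace_W] by (auto simp: g_def PiE_def extensional_def)
  have "(\<Sum>j\<in>{0..p}. g j) = (\<Sum>j\<in>I. f j)"
    using I(2) by (intro sum.mono_neutral_cong_right) (auto simp: g_def)
  then have x: "x = (\<Sum>j\<in>{0..p}. g j)" using I(4) by simp
  show "\<exists>!f. f \<in> (\<Pi>\<^sub>E j\<in>{0..p}. W j) \<and> x = (\<Sum>j\<in>{0..p}. f j)"
  proof (rule ex1I[of _ g])
    fix h assume h: "h \<in> (\<Pi>\<^sub>E j\<in>{0..p}. W j) \<and> x = (\<Sum>j\<in>{0..p}. h j)"
    show "h = g"
    proof (rule PiE_ext[of h "{0..p}" W])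
      fix j assume j: "j \<in> {0..p}"
      have "h j - g j = 0"
      proof (rule W_independent[where d = "\<lambda>j. h j - g j", OF _ _ j])
        show "h i - g i \<in> W i" if "i \<in> {0..p}" for i
          using h g that by (intro subspace_diff[OF subspace_W]) (auto simp: PiE_mem)
        show "(\<Sum>j\<in>{0..p}. h j - g j) = 0" using h x by (simp add: sum_subtractf)
      qed
      then show "h j = g j" by simp
    qed (use g h in auto)
  qed (use g x in blast)
qed

end


section \<open>The classification\<close>

text \<open>The image of \<open>1\<close> under the projection from the Verma module is the highest weight vector.\<close>

lemma is_V_simple_highest_weight:
  fixes q r :: "'k::field"
    and act :: "(agen, 'k) free_alg \<Rightarrow> 'v::ab_group_add \<Rightarrow> 'v"
  assumes q: "q \<noteq> 0" "\<forall>n>0. q ^ n \<noteq> 1" and C0: "central_in_U q C0" and r: "r \<noteq> 0"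
    and V: "is_V q C0 r act"
  obtains v where "simple_highest_weight q act C0 v r"
proof -
  have mod: "left_module act" "\<forall>a\<in>A_ideal q C0. \<forall>v. act a v = 0"
    using V by (auto simp: is_V_def left_module_mod_def)
  obtain \<phi> where \<phi>: "\<forall>a b. \<phi> (a * b) = act a (\<phi> b)" "\<forall>a\<in>A_verma_ideal q C0 r. \<phi> a = 0"
    "range \<phi> = UNIV"
    using V unfolding is_V_def quotient_of_def by blast
  have simple: "simple_submodule act UNIV" using V by (simp add: is_V_def)
  interpret A_module q act C0
    using mod q by unfold_locales auto
  define v where "v = \<phi> 1"
  have \<phi>_eq: "\<phi> a = act a v" for a using \<phi>(1)[rule_format, of a 1] by (simp add: v_def)
  have "v \<noteq> 0"
  proof
    assume "v = 0"
    then have "range \<phi> = {0}" using \<phi>_eq by (auto simp: act.zero)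
    then show False using \<phi>(3) simple by (simp add: simple_submodule_def)
  qed
  moreover have 0: "act a v = 0" if "a \<in> {gen (AU UE), gen AX, gen (AU UK) - const r}" for a
  proof -
    have "a \<in> A_verma_ideal q C0 r" unfolding A_verma_ideal_def using that by (intro hull_inc) auto
    then show ?thesis using \<phi>(2) \<phi>_eq by simp
  qed
  have "E v = 0" "X v = 0" "K v = r \<star> v"
    using 0[of "gen (AU UE)"] 0[of "gen AX"] 0[of "gen (AU UK) - const r"]
    by (simp_all add: act_diff_left)
  ultimately have "simple_highest_weight q act C0 v r"
    using simple C0 r by unfold_locales auto
  then show thesis by (rule that)
qed

theorem theorem4p1:
  fixes q r :: "'k::field"
    and C0 :: "(ugen, 'k) free_alg"
    and act :: "(agen, 'k) free_alg \<Rightarrow> 'v::ab_group_add \<Rightarrow> 'v"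
  assumes char: "CHAR('k) \<noteq> 2"
    and q: "q \<noteq> 0" "\<forall>n>0. q ^ n \<noteq> 1"
    and C0: "central_in_U q C0"
    and r: "r \<noteq> 0"
    and V: "is_V q C0 r act"
  shows "(finite_dim act \<longleftrightarrow>
      (\<exists>n m. (r = q ^ n \<or> r = - (q ^ n)) \<and> m \<le> n \<and> least_alpha_zero q C0 r (n - m + 2)))
    \<and> (\<forall>n m. (r = q ^ n \<or> r = - (q ^ n)) \<and> m \<le> n \<and> least_alpha_zero q C0 r (n - m + 2) \<longrightarrow>
      (\<exists>W. internal_direct_sum {0..n - m} W \<and>
           (\<forall>i\<in>{0..n - m}. is_VC q (q powi (- int i) * r) (restrict_to_U act) (W i))))"
proof -
  obtain v where "simple_highest_weight q act C0 v r"
    using is_V_simple_highest_weight[OF q C0 r V] .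
  then interpret simple_highest_weight q act C0 v r .
  have dom: "dominant_highest_weight q act C0 v r n (n - m)"
    if "(r = q ^ n \<or> r = - (q ^ n)) \<and> m \<le> n \<and> least_alpha_zero q C0 r (n - m + 2)" for n m
    using that by unfold_locales auto
  have "\<exists>n m. (r = q ^ n \<or> r = - (q ^ n)) \<and> m \<le> n \<and> least_alpha_zero q C0 r (n - m + 2)"
    if fin: "finite_dim act"
  proof -
    obtain B where "finite_dimensional_vector_space (\<lambda>c. act (const c)) B"
      using fin by (auto simp: finite_dim_def)
    then have "finite B" "span B = UNIV"
      by (auto simp: finite_dimensional_vector_space_def finite_dimensional_vector_space_axioms_def)
    then obtain n p where np: "r = q ^ n \<or> r = - (q ^ n)" "p \<le> n" "least_alpha_zero q C0 r (p + 2)"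
      using finite_dim_imp_alpha_zero by blast
    then have "n - p \<le> n \<and> least_alpha_zero q C0 r (n - (n - p) + 2)" by simp
    then show ?thesis using np(1) by blast
  qed
  moreover have "finite_dim act"
    if "\<exists>n m. (r = q ^ n \<or> r = - (q ^ n)) \<and> m \<le> n \<and> least_alpha_zero q C0 r (n - m + 2)"
    using that dominant_highest_weight.finite_dim_act[OF dom] by blast
  moreover have "\<exists>W. internal_direct_sum {0..n - m} W \<and>
      (\<forall>i\<in>{0..n - m}. is_VC q (q powi (- int i) * r) (restrict_to_U act) (W i))"
    if "(r = q ^ n \<or> r = - (q ^ n)) \<and> m \<le> n \<and> least_alpha_zero q C0 r (n - m + 2)" for n m
  proof -
    interpret dominant_highest_weight q act C0 v r n "n - m" using dom[OF that] .
    show ?thesis using direct_sum_W is_VC_W by (auto simp: wt_def)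
  qed
  ultimately show ?thesis by blast
qed

end
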